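(* There exists a (randomised) sampling algorithm that, given an undirected graph $G=(V,E)$ with minimum degree at least $3$ and a number $0<\varepsilon<1$, outputs a random orientation $\sigma$ of $G$ such that the distribution of $\sigma$ is $\varepsilon$-close in total variation distance to the uniform distribution over the sink-free orientations of $G$, with running time $O\left(m\log\left(\frac{m}{\varepsilon}\right)\right)$, where $m=|E|$ is the number of edges of $G$.
   Context: Graphs are finite, undirected and not necessarily simple (parallel edges are allowed; each edge joins two distinct vertices). The input graph is given as an adjacency list in which the neighbours of each vertex are arbitrarily ordered. An orientation of $G$ assigns a direction to each edge. A vertex is a sink in an orientation if it has no outgoing edge. An orientation of $G$ is sink-free if every vertex has at least one outgoing edge. For two distributions $P,Q$ over a finite set $\Omega$, their total variation distance is $\frac12\sum_{x\in\Omega}|P(x)-Q(x)|$; two distributions are $\varepsilon$-close if this distance is at most $\varepsilon$. *)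

theory Defs
  imports "HOL-Probability.Probability"
begin

section \<open>Multigraphs and orientations\<close>

text \<open>
  Parallel edges are distinct elements of \<open>edges\<close> with the same set of ends.
\<close>

record ('v, 'e) mgraph =
  verts :: "'v set"
  edges :: "'e set"
  ends  :: "'e \<Rightarrow> 'v set"

definition multigraph :: "('v, 'e) mgraph \<Rightarrow> bool" where
  "multigraph G \<longleftrightarrow> finite (verts G) \<and> verts G \<noteq> {} \<and> finite (edges G) \<and>
     (\<forall>e\<in>edges G. ends G e \<subseteq> verts G \<and> card (ends G e) = 2)"

definition degree :: "('v, 'e) mgraph \<Rightarrow> 'v \<Rightarrow> nat" where
  "degree G v = card {e \<in> edges G. v \<in> ends G e}"

text \<open>
  An orientation is represented by the function mapping each edge to its tail, the end it
  leaves; its head is the other end.  Functions are extensional, so that distinct functions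
  are distinct orientations.
\<close>

definition orientations :: "('v, 'e) mgraph \<Rightarrow> ('e \<Rightarrow> 'v) set" where
  "orientations G = (\<Pi>\<^sub>E e\<in>edges G. ends G e)"

definition is_sink :: "('v, 'e) mgraph \<Rightarrow> ('e \<Rightarrow> 'v) \<Rightarrow> 'v \<Rightarrow> bool" where
  "is_sink G \<sigma> v \<longleftrightarrow> v \<in> verts G \<and> \<not> (\<exists>e\<in>edges G. \<sigma> e = v)"

definition sink_free_orientations :: "('v, 'e) mgraph \<Rightarrow> ('e \<Rightarrow> 'v) set" where
  "sink_free_orientations G = {\<sigma> \<in> orientations G. \<forall>v\<in>verts G. \<not> is_sink G \<sigma> v}"

definition tv_dist :: "'a set \<Rightarrow> 'a pmf \<Rightarrow> 'a pmf \<Rightarrow> real" where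
  "tv_dist \<Omega> P Q = 1 / 2 * (\<Sum>x\<in>\<Omega>. \<bar>pmf P x - pmf Q x\<bar>)"

section \<open>A randomised word RAM\<close>

text \<open>
  The memory consists of named arrays of words, scalars being cell \<open>0\<close> of an array.  A program
  mentions only finitely many names, so this is a RAM with indirect addressing whose memory is
  split into a constant number of segments.  With word size \<open>w\<close>, arithmetic is modulo \<open>2 ^ w\<close>;
  subtraction is truncated at \<open>0\<close> and division by \<open>0\<close> yields \<open>0\<close>.  The only source of randomness
  is the command \<open>Flip x i\<close>, which stores a fresh fair bit in \<open>x[i]\<close>.
\<close>

type_synonym vname = string
type_synonym memory = "vname \<Rightarrow> nat \<Rightarrow> nat"

datatype aexp = N nat | Get vname aexp
  | Plus aexp aexp | Minus aexp aexp | Times aexp aexp | Div aexp aexp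

datatype bexp = Less aexp aexp | Not bexp | And bexp bexp

datatype com = SKIP
  | Assign vname aexp aexp
  | Flip vname aexp
  | Seq com com
  | If bexp com com
  | While bexp com

fun aval :: "nat \<Rightarrow> aexp \<Rightarrow> memory \<Rightarrow> nat" where
  "aval w (N k) s = k mod 2 ^ w"
| "aval w (Get x a) s = s x (aval w a s)"
| "aval w (Plus a b) s = (aval w a s + aval w b s) mod 2 ^ w"
| "aval w (Minus a b) s = aval w a s - aval w b s"
| "aval w (Times a b) s = (aval w a s * aval w b s) mod 2 ^ w"
| "aval w (Div a b) s = aval w a s div aval w b s"

fun bval :: "nat \<Rightarrow> bexp \<Rightarrow> memory \<Rightarrow> bool" where
  "bval w (Less a b) s \<longleftrightarrow> aval w a s < aval w b s"
| "bval w (Not b) s \<longleftrightarrow> \<not> bval w b s"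
| "bval w (And b b') s \<longleftrightarrow> bval w b s \<and> bval w b' s"

definition upd :: "memory \<Rightarrow> vname \<Rightarrow> nat \<Rightarrow> nat \<Rightarrow> memory" where
  "upd s x i k = s(x := (s x)(i := k))"

text \<open>
  A configuration is a stack of commands still to be executed, together with the memory; the
  machine has halted when the stack is empty.  Every step costs one time unit.  As expressions
  are evaluated within a step and a program is fixed independently of its input, a step amounts
  to a constant number of word operations.
\<close>

type_synonym config = "com list \<times> memory"

fun step :: "nat \<Rightarrow> config \<Rightarrow> config pmf" where
  "step w ([], s) = return_pmf ([], s)"
| "step w (SKIP # cs, s) = return_pmf (cs, s)"
| "step w (Assign x i a # cs, s) = return_pmf (cs, upd s x (aval w i s) (aval w a s))"
| "step w (Flip x i # cs, s) =
     map_pmf (\<lambda>b. (cs, upd s x (aval w i s) (of_bool b))) (bernoulli_pmf (1 / 2))"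
| "step w (Seq c d # cs, s) = return_pmf (c # d # cs, s)"
| "step w (If b c d # cs, s) = return_pmf ((if bval w b s then c else d) # cs, s)"
| "step w (While b c # cs, s) =
     return_pmf (if bval w b s then c # While b c # cs else cs, s)"

primrec run :: "nat \<Rightarrow> nat \<Rightarrow> config \<Rightarrow> config pmf" where
  "run w 0 cfg = return_pmf cfg"
| "run w (Suc t) cfg = bind_pmf (step w cfg) (run w t)"

text \<open>\<open>T\<close> bounds the running time whatever the outcomes of the coin flips.\<close>

definition halts_within :: "nat \<Rightarrow> com \<Rightarrow> memory \<Rightarrow> nat \<Rightarrow> bool" where
  "halts_within w prog s T \<longleftrightarrow> (\<forall>cfg\<in>set_pmf (run w T ([prog], s)). fst cfg = [])"

definition final_memory :: "nat \<Rightarrow> com \<Rightarrow> memory \<Rightarrow> nat \<Rightarrow> memory pmf" where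
  "final_memory w prog s T = map_pmf snd (run w T ([prog], s))"

lemma run_halted: "run w t ([], s) = return_pmf ([], s)"
  by (induction t) (simp_all add: bind_return_pmf)

lemma run_add: "run w (t + u) cfg = bind_pmf (run w t cfg) (run w u)"
  by (induction t arbitrary: cfg) (auto simp: bind_return_pmf bind_assoc_pmf intro!: bind_pmf_cong)

text \<open>The final memory does not depend on the chosen bound on the running time.\<close>

lemma final_memory_indep:
  assumes "halts_within w prog s T" "T \<le> U"
  shows "final_memory w prog s U = final_memory w prog s T"
proof -
  have "run w U ([prog], s) = bind_pmf (run w T ([prog], s)) (run w (U - T))"
    using run_add[of w T "U - T"] assms(2) by simp
  also have "\<dots> = bind_pmf (run w T ([prog], s)) return_pmf"
    using assms(1) unfolding halts_within_def
    by (intro bind_pmf_cong) (auto simp: run_halted)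
  finally show ?thesis
    by (simp add: final_memory_def bind_return_pmf')
qed

section \<open>Input and output\<close>

text \<open>
  Vertices and edges of an input graph are numbered from \<open>0\<close>.  The list of a vertex \<open>v\<close> contains,
  in arbitrary order, one pair (neighbour, edge) for each edge at \<open>v\<close>; the edge number
  distinguishes parallel edges and links the two entries of an edge.
\<close>

type_synonym adj_list = "(nat \<times> nat) list list"

definition adj_list_of :: "(nat, nat) mgraph \<Rightarrow> adj_list \<Rightarrow> bool" where
  "adj_list_of G A \<longleftrightarrow>
     verts G = {..<card (verts G)} \<and> edges G = {..<card (edges G)} \<and>
     length A = card (verts G) \<and>
     (\<forall>v\<in>verts G. distinct (A ! v) \<and>
        set (A ! v) = {(u, e). e \<in> edges G \<and> ends G e = {v, u}})"

definition cells :: "nat list \<Rightarrow> nat \<Rightarrow> nat" where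
  "cells xs i = (if i < length xs then xs ! i else 0)"

text \<open>
  The list of vertex \<open>v\<close> occupies the positions from \<open>off[v]\<close> to \<open>off[v + 1] - 1\<close> of the arrays
  \<open>nbr\<close> and \<open>edge\<close>.  The real number \<open>\<epsilon>\<close> is given by its binary expansion: for \<open>k \<ge> 1\<close>, \<open>eps[k]\<close>
  is its \<open>k\<close>-th digit after the point.  All other cells are initially \<open>0\<close>.
\<close>

definition input_memory :: "(nat, nat) mgraph \<Rightarrow> adj_list \<Rightarrow> real \<Rightarrow> memory" where
  "input_memory G A \<epsilon> = (\<lambda>x i. 0)
     (''n''    := cells [card (verts G)],
      ''m''    := cells [card (edges G)],
      ''off''  := cells (map (\<lambda>v. \<Sum>u<v. length (A ! u)) [0..<length A + 1]),
      ''nbr''  := cells (map fst (concat A)),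
      ''edge'' := cells (map snd (concat A)),
      ''eps''  := (\<lambda>k. nat (\<lfloor>\<epsilon> * 2 ^ k\<rfloor> mod 2)))"

text \<open>The program leaves the tail of edge \<open>e\<close> in \<open>out[e]\<close>.\<close>

definition read_orientation :: "(nat, nat) mgraph \<Rightarrow> memory \<Rightarrow> (nat \<Rightarrow> nat)" where
  "read_orientation G s = restrict (s ''out'') (edges G)"

definition output_dist ::
  "nat \<Rightarrow> com \<Rightarrow> (nat, nat) mgraph \<Rightarrow> adj_list \<Rightarrow> real \<Rightarrow> nat \<Rightarrow> (nat \<Rightarrow> nat) pmf" where
  "output_dist w prog G A \<epsilon> T =
     map_pmf (read_orientation G) (final_memory w prog (input_memory G A \<epsilon>) T)"

end

theory Submission
  imports Defs
begin

text \<open>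
  Sink popping with a stack: as long as the stack is non-empty, look at its top vertex; if it is
  a sink, resample its edges and push its neighbours, otherwise pop it.  Given the history, the
  orientation is always uniform among those without sinks in the set of vertices already found
  to be non-sinks, so the output is exactly uniform once the stack is empty.  In minimum degree
  \<open>3\<close> a local lemma bounds the probability that the top vertex \<open>v\<close> is a sink by \<open>(5 / 8)\<^sup>d\<close>, where
  \<open>d\<close> is its degree; as \<open>(d + 1) (5 / 8)\<^sup>d < 1\<close>, the size of the stack has negative drift, and
  an exponential potential shows that \<open>O(m + log (1 / \<epsilon>))\<close> elementary steps suffice with
  probability \<open>1 - \<epsilon>\<close>.  Stopping after that many steps yields the required sampler.
\<close>

section \<open>Orientations with few sinks\<close>

text \<open>The law of the chain is never computed. Instead, the probability of reaching any fixed
  sink-free orientation is bounded from below, by induction on the number of steps and summed over a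
  whole set of starting orientations; such a pointwise bound already controls the total variation
  distance. The obstacle is that edges are resampled one per step, so the induction passes through
  moments at which only some edges at a sink are fresh. The sets
  \<open>constrained W F \<tau>\<close> describe these moments: flipping an edge of \<open>F\<close>
  turns the uniform law on such a set into the one with that edge released. Freezing all edges gives
  a single orientation, so an arbitrary starting point needs no separate treatment.\<close>

locale min_degree_3 =
  fixes G :: "('v, 'e) mgraph"
  assumes multigraph: "multigraph G"
    and degree_ge_3: "v \<in> verts G \<Longrightarrow> 3 \<le> degree G v"
begin

lemma finite_verts [simp]: "finite (verts G)"
  and verts_nonempty: "verts G \<noteq> {}"
  and finite_edges [simp]: "finite (edges G)"
  and ends_subset: "e \<in> edges G \<Longrightarrow> ends G e \<subseteq> verts G"
  and card_ends: "e \<in> edges G \<Longrightarrow> card (ends G e) = 2"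
  using multigraph by (auto simp: multigraph_def)

section \<open>Edge reversal and constrained orientations\<close>

definition incident :: "'v \<Rightarrow> 'e set" where
  "incident v = {e \<in> edges G. v \<in> ends G e}"

definition neighbours :: "'v \<Rightarrow> 'v set" where
  "neighbours v = {u. \<exists>e\<in>edges G. ends G e = {v, u}}"

definition opp :: "'e \<Rightarrow> 'v \<Rightarrow> 'v" where
  "opp e x = (SOME y. y \<in> ends G e - {x})"

definition reverse :: "'e \<Rightarrow> ('e \<Rightarrow> 'v) \<Rightarrow> ('e \<Rightarrow> 'v)" where
  "reverse e \<sigma> = \<sigma>(e := opp e (\<sigma> e))"

lemma opp_props:
  assumes "e \<in> edges G" "x \<in> ends G e"
  shows "ends G e = {x, opp e x}" "opp e x \<noteq> x"
proof -
  from card_ends[OF assms(1)] obtain a b where ab: "ends G e = {a, b}" "a \<noteq> b"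
    by (auto simp: card_2_iff)
  then have "\<exists>y. y \<in> ends G e - {x}" using assms(2) by auto
  then have "opp e x \<in> ends G e - {x}" unfolding opp_def by (rule someI_ex)
  with ab assms(2) show "ends G e = {x, opp e x}" "opp e x \<noteq> x" by auto
qed

lemma opp_eq: "e \<in> edges G \<Longrightarrow> ends G e = {x, y} \<Longrightarrow> opp e x = y"
  using opp_props[of e x] card_ends[of e] by (auto simp: doubleton_eq_iff)

lemma opp_opp: "e \<in> edges G \<Longrightarrow> x \<in> ends G e \<Longrightarrow> opp e (opp e x) = x"
  using opp_props[of e x] opp_eq[of e "opp e x" x] by auto

lemma orientation_end: "\<sigma> \<in> orientations G \<Longrightarrow> e \<in> edges G \<Longrightarrow> \<sigma> e \<in> ends G e"
  by (auto simp: orientations_def PiE_def Pi_def)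

lemma orientation_upd:
  "\<sigma> \<in> orientations G \<Longrightarrow> e \<in> edges G \<Longrightarrow> x \<in> ends G e \<Longrightarrow> \<sigma>(e := x) \<in> orientations G"
  by (auto simp: orientations_def PiE_def Pi_def extensional_def)

lemma reverse_orientation:
  "\<sigma> \<in> orientations G \<Longrightarrow> e \<in> edges G \<Longrightarrow> reverse e \<sigma> \<in> orientations G"
  unfolding reverse_def using opp_props[of e "\<sigma> e"] orientation_end[of \<sigma> e]
  by (intro orientation_upd) auto

lemma reverse_reverse:
  "\<sigma> \<in> orientations G \<Longrightarrow> e \<in> edges G \<Longrightarrow> reverse e (reverse e \<sigma>) = \<sigma>"
  by (auto simp: reverse_def opp_opp orientation_end)

lemma finite_orientations [simp]: "finite (orientations G)"
  unfolding orientations_def using ends_subset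
  by (intro finite_PiE) (auto intro: finite_subset[OF _ finite_verts])

definition constrained :: "'v set \<Rightarrow> 'e set \<Rightarrow> ('e \<Rightarrow> 'v) \<Rightarrow> ('e \<Rightarrow> 'v) set" where
  "constrained W F \<tau> =
     {\<sigma> \<in> orientations G. (\<forall>e\<in>F. \<sigma> e = \<tau> e) \<and> (\<forall>v\<in>W. \<not> is_sink G \<sigma> v)}"

abbreviation sinkless :: "'v set \<Rightarrow> ('e \<Rightarrow> 'v) set" where
  "sinkless W \<equiv> constrained W {} (\<lambda>_. undefined)"

lemma constrained_empty: "constrained W {} \<tau> = sinkless W"
  by (simp add: constrained_def)

lemma finite_constrained [simp]: "finite (constrained W F \<tau>)"
  by (rule finite_subset[OF _ finite_orientations]) (auto simp: constrained_def)

lemma constrained_orientation: "\<sigma> \<in> constrained W F \<tau> \<Longrightarrow> \<sigma> \<in> orientations G"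
  by (simp add: constrained_def)

lemma is_sink_reverse:
  assumes "\<sigma> \<in> orientations G" "e \<in> edges G" "v \<notin> ends G e"
  shows "is_sink G (reverse e \<sigma>) v \<longleftrightarrow> is_sink G \<sigma> v"
proof -
  have "\<sigma> e \<noteq> v" "reverse e \<sigma> e \<noteq> v"
    using orientation_end[OF reverse_orientation] orientation_end assms by metis+
  then show ?thesis unfolding is_sink_def
    by (metis fun_upd_other reverse_def)
qed

lemma reverse_constrained_free:
  assumes "e \<in> edges G" "e \<notin> F" "ends G e \<inter> W = {}" "\<sigma> \<in> constrained W F \<tau>"
  shows "reverse e \<sigma> \<in> constrained W F \<tau>"
  unfolding constrained_def
proof (intro CollectI conjI ballI)
  show "reverse e \<sigma> \<in> orientations G"
    using assms by (simp add: reverse_orientation constrained_def)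
  show "reverse e \<sigma> a = \<tau> a" if "a \<in> F" for a
    using that assms by (auto simp: reverse_def constrained_def)
  show "\<not> is_sink G (reverse e \<sigma>) v" if "v \<in> W" for v
    using that assms is_sink_reverse[of \<sigma> e v] by (auto simp: constrained_def)
qed

text \<open>Reversal is an involution on the set, because \<open>e\<close> is not frozen and has no
  end in \<open>W\<close>. Thus resampling an edge that is already free preserves the uniform
  law.\<close>

lemma sum_reverse_free:
  fixes g :: "_ \<Rightarrow> real"
  assumes "e \<in> edges G" "e \<notin> F" "ends G e \<inter> W = {}"
  shows "(\<Sum>\<sigma>\<in>constrained W F \<tau>. g \<sigma> + g (reverse e \<sigma>)) = 2 * (\<Sum>\<sigma>\<in>constrained W F \<tau>. g \<sigma>)"
proof -
  have "(\<Sum>\<sigma>\<in>constrained W F \<tau>. g (reverse e \<sigma>)) = (\<Sum>\<sigma>\<in>constrained W F \<tau>. g \<sigma>)"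
    by (rule sum.reindex_bij_witness[of _ "reverse e" "reverse e"])
       (use assms in \<open>auto simp: reverse_constrained_free reverse_reverse constrained_orientation\<close>)
  then show ?thesis by (simp add: sum.distrib)
qed

text \<open>Reversal exchanges agreement and disagreement with \<open>\<tau>\<close> at
  \<open>e\<close>, so a set and its image fill the set in which \<open>e\<close> is released:
  resampling a frozen edge keeps uniformity on a larger set.\<close>

lemma sum_reverse_frozen:
  fixes g :: "_ \<Rightarrow> real"
  assumes e: "e \<in> edges G" "e \<in> F" "ends G e \<inter> W = {}" and \<tau>: "\<tau> e \<in> ends G e"
  shows "(\<Sum>\<sigma>\<in>constrained W F \<tau>. g \<sigma> + g (reverse e \<sigma>)) = (\<Sum>\<sigma>\<in>constrained W (F - {e}) \<tau>. g \<sigma>)"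
proof -
  let ?A = "constrained W F \<tau>" and ?B = "constrained W (F - {e}) \<tau>"
  have sub: "?A \<subseteq> ?B" by (auto simp: constrained_def)
  have in_A: "\<sigma> \<in> ?A \<longleftrightarrow> \<sigma> e = \<tau> e" if "\<sigma> \<in> ?B" for \<sigma>
    using that e by (auto simp: constrained_def)
  have rev_B: "reverse e \<sigma> \<in> ?B" if "\<sigma> \<in> ?B" for \<sigma>
    using that e by (intro reverse_constrained_free) auto
  have rev_e: "(reverse e \<sigma> e = \<tau> e) \<longleftrightarrow> \<sigma> e \<noteq> \<tau> e" if "\<sigma> \<in> ?B" for \<sigma>
  proof -
    have "\<sigma> e \<in> ends G e" using that e(1) by (simp add: constrained_orientation orientation_end)
    then have "ends G e = {\<sigma> e, opp e (\<sigma> e)}" "opp e (\<sigma> e) \<noteq> \<sigma> e"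
      using opp_props[OF e(1)] by blast+
    moreover have "reverse e \<sigma> e = opp e (\<sigma> e)" by (simp add: reverse_def)
    ultimately show ?thesis using \<tau> by (metis empty_iff insert_iff)
  qed
  have "(\<Sum>\<sigma>\<in>?A. g (reverse e \<sigma>)) = (\<Sum>\<sigma>\<in>?B - ?A. g \<sigma>)"
    by (rule sum.reindex_bij_witness[of _ "reverse e" "reverse e"])
       (use sub e(1) rev_B rev_e in_A in
         \<open>auto simp: reverse_reverse constrained_orientation dest: subsetD\<close>)
  then show ?thesis
    using sum.subset_diff[OF sub finite_constrained, of g] by (simp add: sum.distrib)
qed

text \<open>By \<open>sum_reverse_frozen\<close> for a constant, each frozen edge away from
  \<open>W\<close> halves the set.\<close>

lemma card_constrained:
  assumes "finite F" "F \<subseteq> edges G" "\<And>e. e \<in> F \<Longrightarrow> ends G e \<inter> W = {} \<and> \<tau> e \<in> ends G e"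
  shows "2 ^ card F * real (card (constrained W F \<tau>)) = real (card (sinkless W))"
  using assms
proof (induction F rule: finite_induct)
  case empty
  then show ?case by (simp add: constrained_empty[of W \<tau>])
next
  case (insert e F)
  have "(\<Sum>\<sigma>\<in>constrained W (insert e F) \<tau>. 1 + 1) =
      (\<Sum>\<sigma>\<in>constrained W (insert e F - {e}) \<tau>. (1::real))"
    using insert.prems by (intro sum_reverse_frozen) auto
  then have "2 * real (card (constrained W (insert e F) \<tau>)) = real (card (constrained W F \<tau>))"
    using insert.hyps by simp
  then show ?case using insert by (simp add: mult.assoc mult.left_commute[of 2])
qed

section \<open>Sinks at a given vertex and a local lemma\<close>

lemma card_neighbours_le: "finite (neighbours v)" "card (neighbours v) \<le> degree G v"
proof -
  have "neighbours v \<subseteq> (\<lambda>e. opp e v) ` incident v"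
    by (auto simp: neighbours_def incident_def opp_eq image_iff) (metis insertI1 opp_eq)
  moreover have "finite (incident v)" by (simp add: incident_def)
  ultimately show "finite (neighbours v)" "card (neighbours v) \<le> degree G v"
    unfolding degree_def incident_def[symmetric]
    by (auto intro: finite_subset le_trans[OF card_mono card_image_le])
qed

lemma ends_incident: "e \<in> incident v \<Longrightarrow> ends G e \<subseteq> insert v (neighbours v)"
  using opp_props[of e v] by (auto simp: incident_def neighbours_def)

text \<open>All edges at a sink leave its neighbours, so these cannot be sinks and their conditions
  come for free; the other vertices of \<open>W\<close> have no edge at \<open>v\<close>. Hence
  finding a sink reveals only the edges at \<open>v\<close> and leaves the rest uniform.\<close>

lemma sink_constrained:
  assumes v: "v \<in> verts G" "v \<notin> W"
  shows "{\<sigma> \<in> sinkless W. is_sink G \<sigma> v} =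
    constrained (W - neighbours v) (incident v) (\<lambda>e. opp e v)" (is "?L = ?R")
proof (intro Set.equalityI subsetI)
  fix \<sigma> assume "\<sigma> \<in> ?L"
  then have \<sigma>: "\<sigma> \<in> orientations G" "\<forall>u\<in>W. \<not> is_sink G \<sigma> u" "is_sink G \<sigma> v"
    by (auto simp: constrained_def)
  have "\<sigma> e = opp e v" if "e \<in> incident v" for e
  proof -
    from that have e: "e \<in> edges G" "v \<in> ends G e" by (auto simp: incident_def)
    have "\<sigma> e \<noteq> v" using \<sigma>(3) e by (auto simp: is_sink_def)
    then show ?thesis using opp_props(1)[OF e] orientation_end[OF \<sigma>(1) e(1)] by auto
  qed
  then show "\<sigma> \<in> ?R" using \<sigma> by (auto simp: constrained_def)
next
  fix \<sigma> assume "\<sigma> \<in> ?R"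
  then have \<sigma>: "\<sigma> \<in> orientations G" "\<And>e. e \<in> incident v \<Longrightarrow> \<sigma> e = opp e v"
     "\<And>u. u \<in> W - neighbours v \<Longrightarrow> \<not> is_sink G \<sigma> u"
    by (auto simp: constrained_def)
  have "\<sigma> e \<noteq> v" if e: "e \<in> edges G" for e
    using \<sigma>(2)[of e] orientation_end[OF \<sigma>(1) e] opp_props(2)[OF e, of v] e
    by (cases "v \<in> ends G e") (auto simp: incident_def)
  then have "is_sink G \<sigma> v" using v by (auto simp: is_sink_def)
  moreover have "\<not> is_sink G \<sigma> u" if u: "u \<in> neighbours v" for u
  proof -
    from u obtain e where e: "e \<in> edges G" "ends G e = {v, u}" by (auto simp: neighbours_def)
    then have "\<sigma> e = u" using \<sigma>(2)[of e] opp_eq[of e v u] by (auto simp: incident_def)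
    then show ?thesis using e by (auto simp: is_sink_def)
  qed
  ultimately show "\<sigma> \<in> ?L" using \<sigma> by (auto simp: constrained_def)
qed

lemma card_sink:
  assumes v: "v \<in> verts G" "v \<notin> W"
  shows "2 ^ degree G v * real (card {\<sigma> \<in> sinkless W. is_sink G \<sigma> v}) =
    real (card (sinkless (W - neighbours v)))"
proof -
  have "2 ^ card (incident v) *
      real (card (constrained (W - neighbours v) (incident v) (\<lambda>e. opp e v))) =
    real (card (sinkless (W - neighbours v)))"
  proof (rule card_constrained)
    fix e assume e: "e \<in> incident v"
    then show "ends G e \<inter> (W - neighbours v) = {} \<and> opp e v \<in> ends G e"
      using ends_incident[OF e] v opp_props(1)[of e v] by (auto simp: incident_def)
  qed (auto simp: incident_def)
  then show ?thesis by (simp add: sink_constrained[OF v] degree_def incident_def)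
qed

lemma sinkless_insert: "sinkless (insert u W) = sinkless W - {\<sigma> \<in> sinkless W. is_sink G \<sigma> u}"
  by (auto simp: constrained_def)

lemma card_sinkless_insert:
  "real (card (sinkless (insert u W))) =
   real (card (sinkless W)) - real (card {\<sigma> \<in> sinkless W. is_sink G \<sigma> u})"
  unfolding sinkless_insert by (subst card_Diff_subset) (auto simp: of_nat_diff card_mono)

text \<open>
  To bound the probability of a sink at \<open>v\<close> given that there is none in \<open>W\<close>, the neighbours of
  \<open>v\<close> are released from \<open>W\<close> one at a time; each of them then has the free neighbour \<open>v\<close>, and \<open>1 / 5\<close> satisfies
  \<open>2\<^sup>-\<^sup>d (1 - 1 / 5)\<^sup>-\<^sup>(\<^sup>d\<^sup>-\<^sup>1\<^sup>) \<le> 1 / 5\<close> for \<open>d \<ge> 3\<close>.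
\<close>

lemma card_sink_le_pow:
  assumes v: "v \<in> verts G" "v \<notin> W"
    and step: "\<And>u W'. u \<in> W \<Longrightarrow> u \<in> neighbours v \<Longrightarrow> W' \<subseteq> W - {u} \<Longrightarrow>
        5 * real (card {\<sigma> \<in> sinkless W'. is_sink G \<sigma> u}) \<le> real (card (sinkless W'))"
  shows "2 ^ degree G v * real (card {\<sigma> \<in> sinkless W. is_sink G \<sigma> v}) \<le>
     (5 / 4) ^ card (W \<inter> neighbours v) * real (card (sinkless W))"
proof -
  have fin: "finite X" if "X \<subseteq> W \<inter> neighbours v" for X
    using that card_neighbours_le(1) by (meson finite_subset inf_le2 order_trans)
  have "real (card (sinkless (W - neighbours v))) \<le>
      (5 / 4) ^ card X * real (card (sinkless ((W - neighbours v) \<union> X)))"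
    if "X \<subseteq> W \<inter> neighbours v" for X
    using fin[OF that] that
  proof (induction X rule: finite_induct)
    case empty
    then show ?case by simp
  next
    case (insert u X)
    let ?W = "(W - neighbours v) \<union> X"
    have "5 * real (card {\<sigma> \<in> sinkless ?W. is_sink G \<sigma> u}) \<le> real (card (sinkless ?W))"
      using insert by (intro step) auto
    then have le: "real (card (sinkless ?W)) \<le> 5 / 4 * real (card (sinkless (insert u ?W)))"
      unfolding card_sinkless_insert by simp
    have "real (card (sinkless (W - neighbours v))) \<le> (5 / 4) ^ card X * real (card (sinkless ?W))"
      using insert by auto
    also have "\<dots> \<le> (5 / 4) ^ card X * (5 / 4 * real (card (sinkless (insert u ?W))))"
      by (intro mult_left_mono le) simp
    finally show ?case using insert.hyps by (simp add: ac_simps)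
  qed
  from this[of "W \<inter> neighbours v"] show ?thesis
    unfolding card_sink[OF v] by (simp add: Un_Int_distrib Un_Diff_Int Un_absorb1)
qed

text \<open>Induction on \<open>W\<close> as in the local lemma: a neighbour \<open>x\<close> of
  \<open>v\<close> in \<open>W\<close> is treated with a set inside \<open>W - {x}\<close>, where
  \<open>v\<close> is its free neighbour. The free neighbour \<open>u\<close> of \<open>v\<close>
  limits the number of released vertices to \<open>d - 1\<close>.\<close>

lemma card_sink_le_fifth:
  assumes "finite W" "v \<in> verts G" "v \<notin> W" "u \<in> neighbours v" "u \<notin> W" "W \<subseteq> verts G"
  shows "5 * real (card {\<sigma> \<in> sinkless W. is_sink G \<sigma> v}) \<le> real (card (sinkless W))"
  using assms
proof (induction W arbitrary: v u rule: finite_psubset_induct)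
  case (psubset W)
  define d where "d = degree G v"
  have d3: "3 \<le> d" using degree_ge_3 psubset.prems by (simp add: d_def)
  have pow: "2 ^ d * real (card {\<sigma> \<in> sinkless W. is_sink G \<sigma> v}) \<le>
     (5 / 4) ^ card (W \<inter> neighbours v) * real (card (sinkless W))"
    unfolding d_def
  proof (rule card_sink_le_pow)
    fix x W' assume x: "x \<in> W" "x \<in> neighbours v" "W' \<subseteq> W - {x}"
    then have "v \<in> neighbours x" by (auto simp: neighbours_def insert_commute)
    then show "5 * real (card {\<sigma> \<in> sinkless W'. is_sink G \<sigma> x}) \<le> real (card (sinkless W'))"
      using x psubset.prems by (intro psubset.IH[of W' x v]) auto
  qed (use psubset.prems in auto)
  have "card (W \<inter> neighbours v) < card (neighbours v)"
    using psubset.prems card_neighbours_le(1) by (intro psubset_card_mono) auto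
  then have "card (W \<inter> neighbours v) \<le> d - 1"
    using card_neighbours_le(2)[of v] by (simp add: d_def)
  then have "(5 / 4) ^ card (W \<inter> neighbours v) \<le> (5 / 4 :: real) ^ (d - 1)"
    by (intro power_increasing) auto
  \<comment> \<open>For \<open>d = 3\<close> this is 125 / 16 \<le> 8; for \<open>d = 2\<close> it
    would fail, since 25 / 4 > 4. Each further edge costs 5 / 4 on the left and gains 2 on the
    right.\<close>
  also have "5 * \<dots> \<le> 2 ^ d"
    using d3
  proof (induction d rule: nat_induct_at_least)
    case base
    then show ?case by (simp add: eval_nat_numeral)
  next
    case (Suc d)
    have "(5 / 4 :: real) ^ (Suc d - 1) = 5 / 4 * (5 / 4) ^ (d - 1)"
      using Suc.hyps by (cases d) auto
    moreover have "0 \<le> (2 :: real) ^ d" by simp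
    ultimately show ?case using Suc.IH unfolding power_Suc by linarith
  qed
  finally have "5 * (5 / 4) ^ card (W \<inter> neighbours v) \<le> (2 :: real) ^ d" by simp
  then have "5 * (5 / 4) ^ card (W \<inter> neighbours v) * real (card (sinkless W)) \<le>
      2 ^ d * real (card (sinkless W))"
    by (intro mult_right_mono) auto
  with pow have "2 ^ d * (5 * real (card {\<sigma> \<in> sinkless W. is_sink G \<sigma> v})) \<le>
      2 ^ d * real (card (sinkless W))"
    by linarith
  then show ?case by simp
qed

text \<open>All neighbours of \<open>v\<close> may lie in \<open>W\<close>, so the exponent is now
  the full degree; the neighbours still obey the bound 1 / 5, with \<open>v\<close> as their free
  neighbour.\<close>

lemma card_sink_le:
  assumes v: "v \<in> verts G" "v \<notin> W" and W: "W \<subseteq> verts G"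
  shows "real (card {\<sigma> \<in> sinkless W. is_sink G \<sigma> v}) \<le>
     (5 / 8) ^ degree G v * real (card (sinkless W))"
proof -
  have fin: "finite W" using W by (rule finite_subset) simp
  have "2 ^ degree G v * real (card {\<sigma> \<in> sinkless W. is_sink G \<sigma> v}) \<le>
     (5 / 4) ^ card (W \<inter> neighbours v) * real (card (sinkless W))"
  proof (rule card_sink_le_pow[OF v])
    fix x W' assume x: "x \<in> W" "x \<in> neighbours v" "W' \<subseteq> W - {x}"
    then have "v \<in> neighbours x" by (auto simp: neighbours_def insert_commute)
    then show "5 * real (card {\<sigma> \<in> sinkless W'. is_sink G \<sigma> x}) \<le> real (card (sinkless W'))"
      using x v W by (intro card_sink_le_fifth[of W' x v]) (auto intro: finite_subset[OF _ fin])
  qed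
  also have "card (W \<inter> neighbours v) \<le> degree G v"
    using card_neighbours_le[of v] by (meson card_mono inf_le2 le_trans)
  then have "(5 / 4) ^ card (W \<inter> neighbours v) * real (card (sinkless W)) \<le>
      (5 / 4) ^ degree G v * real (card (sinkless W))"
    by (intro mult_right_mono power_increasing) auto
  also have "(5 / 4 :: real) ^ degree G v = 2 ^ degree G v * (5 / 8) ^ degree G v"
    by (simp flip: power_mult_distrib)
  finally show ?thesis by (simp add: mult.assoc)
qed

lemma sink_free_eq: "sink_free_orientations G = sinkless (verts G)"
  by (auto simp: sink_free_orientations_def constrained_def)

text \<open>Each vertex added to \<open>W\<close> retains at least the fraction
  \<open>1 - (5 / 8) ^ 3\<close> of the orientations.\<close>

lemma sink_free_nonempty: "sink_free_orientations G \<noteq> {}"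
proof -
  have "sinkless W \<noteq> {}" if "finite W" "W \<subseteq> verts G" for W
    using that
  proof (induction W rule: finite_induct)
    case empty
    have "ends G e \<noteq> {}" if "e \<in> edges G" for e using card_ends[OF that] by auto
    then show ?case by (simp add: constrained_def orientations_def PiE_eq_empty_iff)
  next
    case (insert v W)
    have "(5 / 8 :: real) ^ degree G v \<le> (5 / 8) ^ 3"
      using degree_ge_3[of v] insert by (intro power_decreasing) auto
    then have "(5 / 8) ^ degree G v * real (card (sinkless W)) \<le> (5 / 8) ^ 3 * real (card (sinkless W))"
      by (intro mult_right_mono) auto
    with card_sink_le[of v W] insert
    have "real (card (sinkless (insert v W))) \<ge> (1 - (5 / 8) ^ 3) * real (card (sinkless W))"
      by (simp add: card_sinkless_insert algebra_simps)
    moreover have "(1 - (5 / 8) ^ 3) * real (card (sinkless W)) > 0"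
      using insert by (auto simp: eval_nat_numeral card_gt_0_iff)
    ultimately show ?case by (metis card.empty less_le_not_le of_nat_0 order_less_le_trans)
  qed
  then show ?thesis using sink_free_eq by simp
qed

end

section \<open>Sink popping\<close>

text \<open>The shortfall of \<open>P\<close> at \<open>x\<close> is at most
  \<open>\<epsilon> * pmf Q x\<close>, and as \<open>P\<close> has mass at most 1 on
  \<open>\<Omega>\<close>, its total excess does not exceed its total shortfall.\<close>

lemma tv_dist_le_of_ge:
  assumes "finite \<Omega>" "set_pmf Q \<subseteq> \<Omega>" and ge: "\<And>x. (1 - \<epsilon>) * pmf Q x \<le> pmf P x"
  shows "tv_dist \<Omega> P Q \<le> \<epsilon>"
proof -
  have Q: "(\<Sum>x\<in>\<Omega>. pmf Q x) = 1" using assms by (intro sum_pmf_eq_1)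
  have P: "(\<Sum>x\<in>\<Omega>. pmf P x) \<le> 1"
    using measure_measure_pmf_finite[OF assms(1), of P] measure_pmf.prob_le_1[of P \<Omega>] by simp
  show ?thesis
  proof (cases "0 \<le> \<epsilon>")
    case True
    have "\<bar>pmf P x - pmf Q x\<bar> \<le> pmf P x - pmf Q x + 2 * \<epsilon> * pmf Q x" for x
    proof -
      have "0 \<le> \<epsilon> * pmf Q x" using True by simp
      then show ?thesis using ge[of x] by (auto simp: abs_if algebra_simps)
    qed
    then have "(\<Sum>x\<in>\<Omega>. \<bar>pmf P x - pmf Q x\<bar>) \<le> (\<Sum>x\<in>\<Omega>. pmf P x - pmf Q x + 2 * \<epsilon> * pmf Q x)"
      by (intro sum_mono)
    also have "\<dots> \<le> 2 * \<epsilon>"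
      using P Q by (simp add: sum.distrib sum_subtractf flip: sum_distrib_left)
    finally show ?thesis by (simp add: tv_dist_def)
  next
    case False
    have "(1 - \<epsilon>) * (\<Sum>x\<in>\<Omega>. pmf Q x) \<le> (\<Sum>x\<in>\<Omega>. pmf P x)"
      unfolding sum_distrib_left by (intro sum_mono ge)
    then show ?thesis using P Q False by simp
  qed
qed

section \<open>The popping chain and its potential\<close>

type_synonym ('v, 'e) popping_state = "('e \<Rightarrow> 'v) \<times> 'v list \<times> ('v \<times> 'e) list"

text \<open>To first order in \<open>\<gamma> - 1\<close>, negative drift at degree 3 means
  \<open>4 * (5 / 8) ^ 3 = 125 / 128 < 1\<close>. The margin is thin: \<open>\<gamma>\<close> is
  close to 1 to keep the higher-order terms within it, and \<open>\<beta> - 1\<close> uses up most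
  of what remains.\<close>

definition \<gamma> :: real where "\<gamma> = 101 / 100"
definition \<beta> :: real where "\<beta> = 25001 / 25000"

text \<open>
  A pending entry costs one step and adds one element to the stack, hence weighs \<open>\<beta>\<close> times as much
  as a stack element.
\<close>

definition potential :: "'v list \<Rightarrow> ('v \<times> 'e) list \<Rightarrow> real" where
  "potential S P = (\<gamma> / \<beta>) ^ length S * \<gamma> ^ length P"

lemma \<beta>_gt_1: "1 < \<beta>" and \<gamma>_gt_\<beta>: "\<beta> < \<gamma>"
  by (simp_all add: \<gamma>_def \<beta>_def)

lemma potential_ge_1: "1 \<le> potential S P"
  unfolding potential_def using \<beta>_gt_1 \<gamma>_gt_\<beta>
  by (intro mult_ge1_I one_le_power) (auto simp: field_simps)

lemma potential_push: "potential (u # S) P = potential S (x # P) / \<beta>"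
  by (simp add: potential_def)

text \<open>This is the check of a top vertex of degree \<open>d\<close>: a sink stays on the stack
  and gains \<open>d\<close> entries, hence \<open>Suc d\<close>; the stack element checked weighs
  \<open>\<gamma> / \<beta>\<close>, and the second \<open>\<beta>\<close> pays for the step. Degree
  3 is the worst case.\<close>

lemma drift:
  assumes "3 \<le> d"
  shows "(5 / 8) ^ d * (\<gamma> ^ Suc d - 1) \<le> \<gamma> / \<beta>\<^sup>2 - 1"
proof -
  have "(5 / 8) ^ d * (\<gamma> ^ Suc d - 1) \<le> (5 / 8) ^ 3 * (\<gamma> ^ 4 - 1)"
    using assms
  proof (induction d rule: nat_induct_at_least)
    case base
    then show ?case by simp
  next
    case (Suc d)
    have "\<gamma> ^ 4 \<le> \<gamma> ^ Suc d"
      using Suc.hyps by (intro power_increasing) (auto simp: \<gamma>_def)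
    moreover have "\<gamma> ^ 4 \<ge> 104 / 100" by (simp add: \<gamma>_def eval_nat_numeral)
    ultimately have "5 * (\<gamma> * \<gamma> ^ Suc d - 1) \<le> 8 * (\<gamma> ^ Suc d - 1)"
      by (simp add: \<gamma>_def)
    then have "(5 / 8) ^ d * (5 / 8 * (\<gamma> * \<gamma> ^ Suc d - 1)) \<le> (5 / 8) ^ d * (\<gamma> ^ Suc d - 1)"
      by (intro mult_left_mono) auto
    moreover have "(5 / 8) ^ Suc d * (\<gamma> ^ Suc (Suc d) - 1) =
        (5 / 8) ^ d * (5 / 8 * (\<gamma> * \<gamma> ^ Suc d - 1))"
      by (simp only: power_Suc ac_simps)
    ultimately show ?case using Suc.IH by linarith
  qed
  also have "\<dots> \<le> \<gamma> / \<beta>\<^sup>2 - 1"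
    by (simp add: \<gamma>_def \<beta>_def eval_nat_numeral)
  finally show ?thesis .
qed

locale adjacency = min_degree_3 G for G :: "('v, 'e) mgraph" +
  fixes adj :: "'v \<Rightarrow> ('v \<times> 'e) list"
  assumes adj: "v \<in> verts G \<Longrightarrow> set (adj v) = {(u, e). e \<in> edges G \<and> ends G e = {v, u}}"
    and length_adj: "v \<in> verts G \<Longrightarrow> length (adj v) = degree G v"
begin

text \<open>
  The list \<open>P\<close> holds the adjacency entries whose edges are yet to be resampled; the sink under
  treatment stays on the stack \<open>S\<close> and is checked again later.
\<close>

fun pop_step :: "('v, 'e) popping_state \<Rightarrow> ('v, 'e) popping_state pmf" where
  "pop_step (\<sigma>, S, (u, e) # P) =
     map_pmf (\<lambda>b. (\<sigma>(e := if b then u else opp e u), u # S, P)) (bernoulli_pmf (1 / 2))"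
| "pop_step (\<sigma>, v # S, []) =
     return_pmf (if is_sink G \<sigma> v then (\<sigma>, v # S, adj v) else (\<sigma>, S, []))"
| "pop_step (\<sigma>, [], []) = return_pmf (\<sigma>, [], [])"

primrec popping :: "nat \<Rightarrow> ('v, 'e) popping_state \<Rightarrow> ('e \<Rightarrow> 'v) pmf" where
  "popping 0 a = return_pmf (fst a)"
| "popping (Suc t) a = bind_pmf (pop_step a) (popping t)"

lemma pmf_bind_bernoulli_half:
  "pmf (bind_pmf (bernoulli_pmf (1 / 2)) f) x = (pmf (f True) x + pmf (f False) x) / 2"
  by (simp add: pmf_bind)

text \<open>The current tail is one of the two ends, so up to order the two outcomes are
  \<open>\<sigma>\<close> and its reversal; this makes the reversal sums applicable.\<close>

lemma pmf_popping_edge: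
  assumes "\<sigma> \<in> orientations G" "e \<in> edges G" "u \<in> ends G e"
  shows "pmf (popping (Suc t) (\<sigma>, S, (u, e) # P)) x =
    (pmf (popping t (\<sigma>, u # S, P)) x + pmf (popping t (reverse e \<sigma>, u # S, P)) x) / 2"
proof -
  have \<sigma>e: "\<sigma> e = u \<or> \<sigma> e = opp e u"
    using orientation_end[OF assms(1,2)] opp_props(1)[OF assms(2,3)] by auto
  have "pmf (popping (Suc t) (\<sigma>, S, (u, e) # P)) x =
    (pmf (popping t (\<sigma>(e := u), u # S, P)) x + pmf (popping t (\<sigma>(e := opp e u), u # S, P)) x) / 2"
    by (simp add: bind_map_pmf pmf_bind_bernoulli_half)
  moreover have "\<sigma>(e := \<sigma> e) = \<sigma>" by simp
  ultimately show ?thesis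
    using \<sigma>e opp_opp[OF assms(2,3)] unfolding reverse_def by (metis add.commute)
qed

lemma popping_halted: "popping t (\<sigma>, [], []) = return_pmf \<sigma>"
  by (induction t) (auto simp: bind_return_pmf)

text \<open>With nothing left to treat, the cover condition forces \<open>W = verts G\<close>; each
  sink-free orientation is returned unchanged, so the sum is exactly 1. This serves the base case
  and the idle steps alike.\<close>

lemma popping_lower_bound_halted:
  assumes x: "x \<in> sink_free_orientations G"
    and "F \<subseteq> snd ` set P" "verts G \<subseteq> W \<union> set S \<union> fst ` set P" "W \<subseteq> verts G" "S = []" "P = []"
  shows "real (card (constrained W F \<tau>)) * (1 - potential S P / \<beta> ^ t) \<le>
    real (card (sink_free_orientations G)) *
      (\<Sum>\<sigma>\<in>constrained W F \<tau>. pmf (popping t (\<sigma>, S, P)) x)"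
proof -
  have W: "W = verts G" "F = {}" using assms by auto
  then have eq: "constrained W F \<tau> = sink_free_orientations G"
    by (simp add: sink_free_eq constrained_empty[of "verts G" \<tau>])
  have "finite (sink_free_orientations G)" by (simp add: sink_free_eq)
  then have "(\<Sum>\<sigma>\<in>sink_free_orientations G. pmf (popping t (\<sigma>, S, P)) x) = 1"
    using x assms by (simp add: popping_halted indicator_def)
  moreover have "0 \<le> potential S P / \<beta> ^ t"
    using potential_ge_1[of S P] \<beta>_gt_1 by simp
  ultimately show ?thesis
    unfolding eq by (simp add: mult_left_le)
qed

text \<open>
  Given the course of the algorithm so far, the orientation is uniform on
  \<open>constrained W F \<tau>\<close>, where \<open>F\<close> consists of the edges not yet resampled.  Hence each sink-free
  orientation is equally likely to be the output, however long the run takes.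
\<close>

lemma popping_lower_bound:
  assumes F: "F \<subseteq> snd ` set P" "\<And>e. e \<in> F \<Longrightarrow> \<tau> e \<in> ends G e"
    and P: "\<And>u e. (u, e) \<in> set P \<Longrightarrow> e \<in> edges G \<and> u \<in> ends G e \<and> ends G e \<inter> W = {}"
    and cover: "verts G \<subseteq> W \<union> set S \<union> fst ` set P" and S: "set S \<subseteq> verts G" and W: "W \<subseteq> verts G"
    and x: "x \<in> sink_free_orientations G"
  shows "real (card (constrained W F \<tau>)) * (1 - potential S P / \<beta> ^ t) \<le>
    real (card (sink_free_orientations G)) *
      (\<Sum>\<sigma>\<in>constrained W F \<tau>. pmf (popping t (\<sigma>, S, P)) x)"
  using F P cover S W
proof (induction t arbitrary: W F \<tau> S P)
  case (0 W F \<tau> S P)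
  show ?case
  proof (cases "S = [] \<and> P = []")
    case True
    with popping_lower_bound_halted[OF x, of F P W S \<tau> 0] 0 show ?thesis by blast
  next
    case False
    \<comment> \<open>Without any step left, a potential of at least 1 makes the bound
      trivial.\<close>
    have "1 - potential S P \<le> 0" using potential_ge_1 by simp
    then have "real (card (constrained W F \<tau>)) * (1 - potential S P / \<beta> ^ 0) \<le> 0"
      by (simp add: mult_nonneg_nonpos)
    also have "\<dots> \<le> real (card (sink_free_orientations G)) *
      (\<Sum>\<sigma>\<in>constrained W F \<tau>. pmf (popping 0 (\<sigma>, S, P)) x)"
      by (intro mult_nonneg_nonneg sum_nonneg) auto
    finally show ?thesis .
  qed
next
  case (Suc t W F \<tau> S P)
  let ?N = "real (card (sink_free_orientations G))"
  show ?case
  proof (cases P)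
    case (Cons ue Q)
    obtain u e where ue: "ue = (u, e)" by (cases ue)
    have e: "e \<in> edges G" "u \<in> ends G e" "ends G e \<inter> W = {}"
      using Suc.prems(3)[of u e] by (auto simp: Cons ue)
    let ?g = "\<lambda>\<sigma>. pmf (popping t (\<sigma>, u # S, Q)) x"
    have "real (card (constrained W (F - {e}) \<tau>)) * (1 - potential (u # S) Q / \<beta> ^ t) \<le>
      ?N * (\<Sum>\<sigma>\<in>constrained W (F - {e}) \<tau>. ?g \<sigma>)"
    proof (rule Suc.IH)
      show "F - {e} \<subseteq> snd ` set Q" using Suc.prems(1) by (auto simp: Cons ue)
      show "set (u # S) \<subseteq> verts G" using Suc.prems(5) ends_subset e by auto
      show "verts G \<subseteq> W \<union> set (u # S) \<union> fst ` set Q" using Suc.prems(4) by (auto simp: Cons ue)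
      show "e' \<in> edges G \<and> u' \<in> ends G e' \<and> ends G e' \<inter> W = {}" if "(u', e') \<in> set Q" for u' e'
        using Suc.prems(3)[of u' e'] that by (simp add: Cons)
    qed (use Suc.prems in \<open>auto simp: Cons\<close>)
    \<comment> \<open>Trading an entry for a stack element lowers the potential by exactly the
      factor \<open>\<beta>\<close> that the step costs.\<close>
    moreover have "potential (u # S) Q / \<beta> ^ t = potential S P / \<beta> ^ Suc t"
      using potential_push[of u S Q ue] by (simp add: Cons)
    moreover have "(\<Sum>\<sigma>\<in>constrained W F \<tau>. pmf (popping (Suc t) (\<sigma>, S, P)) x) =
        (\<Sum>\<sigma>\<in>constrained W F \<tau>. ?g \<sigma> + ?g (reverse e \<sigma>)) / 2"
      unfolding sum_divide_distrib Cons ue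
      by (intro sum.cong refl pmf_popping_edge) (use e in \<open>auto simp: constrained_orientation\<close>)
    \<comment> \<open>\<open>k = 1\<close> if the flip releases \<open>e\<close>;
      \<open>k = 2\<close> if \<open>e\<close> was free before, as at the second entry of an edge in
      the initial list. The sizes of the two sets have ratio \<open>k / 2\<close>.\<close>
    moreover have "\<exists>k::real. k > 0 \<and>
        (\<Sum>\<sigma>\<in>constrained W F \<tau>. ?g \<sigma> + ?g (reverse e \<sigma>)) = k * (\<Sum>\<sigma>\<in>constrained W (F - {e}) \<tau>. ?g \<sigma>) \<and>
        2 * real (card (constrained W F \<tau>)) = k * real (card (constrained W (F - {e}) \<tau>))"
    proof (cases "e \<in> F")
      case True
      have \<tau>: "\<tau> e \<in> ends G e" using Suc.prems(2) True by blast
      from sum_reverse_frozen[where e = e and F = F and W = W and \<tau> = \<tau> and g = "\<lambda>_. 1"]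
        sum_reverse_frozen[where e = e and F = F and W = W and \<tau> = \<tau> and g = ?g] e True \<tau>
      show ?thesis by (intro exI[of _ 1]) simp
    next
      case False
      from sum_reverse_free[where e = e and F = F and W = W and \<tau> = \<tau> and g = ?g] e False
      show ?thesis by (intro exI[of _ 2]) simp
    qed
    then obtain k :: real where k: "k > 0"
      "(\<Sum>\<sigma>\<in>constrained W F \<tau>. ?g \<sigma> + ?g (reverse e \<sigma>)) = k * (\<Sum>\<sigma>\<in>constrained W (F - {e}) \<tau>. ?g \<sigma>)"
      "real (card (constrained W F \<tau>)) = k / 2 * real (card (constrained W (F - {e}) \<tau>))"
      by auto
    ultimately have "real (card (constrained W (F - {e}) \<tau>)) * (1 - potential S P / \<beta> ^ Suc t) \<le>
      ?N * (\<Sum>\<sigma>\<in>constrained W (F - {e}) \<tau>. ?g \<sigma>)"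
      by simp
    then have "k / 2 * (real (card (constrained W (F - {e}) \<tau>)) * (1 - potential S P / \<beta> ^ Suc t)) \<le>
      k / 2 * (?N * (\<Sum>\<sigma>\<in>constrained W (F - {e}) \<tau>. ?g \<sigma>))"
      using k(1) by (intro mult_left_mono) auto
    then show ?thesis
      unfolding k(3) \<open>(\<Sum>\<sigma>\<in>constrained W F \<tau>. pmf (popping (Suc t) (\<sigma>, S, P)) x) = _\<close> k(2)
      by (simp only: ac_simps times_divide_eq_right times_divide_eq_left)
  next
    case Nil
    then have F: "F = {}" using Suc.prems(1) by auto
    show ?thesis
    proof (cases S)
      case Nil': Nil
      with popping_lower_bound_halted[OF x, of F P W S \<tau> "Suc t"] Nil Suc.prems show ?thesis
        by blast
    next
      case Cons: (Cons v S')
      define A where "A = constrained W {} \<tau>"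
      define A1 where "A1 = {\<sigma> \<in> A. is_sink G \<sigma> v}"
      define A2 where "A2 = {\<sigma> \<in> A. \<not> is_sink G \<sigma> v}"
      have v: "v \<in> verts G" using Suc.prems(5) Cons by auto
      define d where "d = degree G v"
      have A: "A = sinkless W" by (simp add: A_def constrained_empty[of W \<tau>])
      have AA: "A = A1 \<union> A2" "A1 \<inter> A2 = {}" "finite A1" "finite A2"
        by (auto simp: A1_def A2_def A)
      have cardA: "real (card A) = real (card A1) + real (card A2)"
        using AA by (simp add: card_Un_disjoint)
      have A1_le: "real (card A1) \<le> (5 / 8) ^ d * real (card A)"
      \<comment> \<open>A vertex can be on the stack several times and thus already be known not to
        be a sink.\<close>
      proof (cases "v \<in> W")
        case True
        then have "A1 = {}" by (auto simp: A1_def A constrained_def)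
        then show ?thesis by simp
      next
        case False
        then show ?thesis using card_sink_le[OF v _ Suc.prems(6)] by (simp add: A1_def A d_def)
      qed
      let ?g1 = "\<lambda>\<sigma>. pmf (popping t (\<sigma>, v # S', adj v)) x"
      let ?g2 = "\<lambda>\<sigma>. pmf (popping t (\<sigma>, S', [])) x"
      let ?\<delta>1 = "potential (v # S') (adj v) / \<beta> ^ t"
      let ?\<delta>2 = "potential S' ([] :: ('v \<times> 'e) list) / \<beta> ^ t"
      let ?\<delta> = "potential S P / \<beta> ^ Suc t"
      have 1: "real (card A1) * (1 - ?\<delta>1) \<le> ?N * (\<Sum>\<sigma>\<in>A1. ?g1 \<sigma>)"
      proof (cases "v \<in> W")
        case True
        then have "A1 = {}" by (auto simp: A1_def A constrained_def)
        then show ?thesis by simp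
      next
        case False
        have inc: "snd ` set (adj v) = incident v"
          using opp_props(1)[of _ v] by (force simp: adj[OF v] incident_def image_iff)
        have nb: "fst ` set (adj v) = neighbours v"
          by (force simp: adj[OF v] neighbours_def image_iff)
        \<comment> \<open>The sink case is again a constrained set, with the neighbours dropped from
          \<open>W\<close> and all edges at \<open>v\<close> frozen towards \<open>v\<close>, so the
          induction hypothesis covers it.\<close>
        have "A1 = constrained (W - neighbours v) (incident v) (\<lambda>e. opp e v)"
          unfolding A1_def A using v False by (rule sink_constrained)
        moreover have "real (card (constrained (W - neighbours v) (incident v) (\<lambda>e. opp e v))) * (1 - ?\<delta>1) \<le>
           ?N * (\<Sum>\<sigma>\<in>constrained (W - neighbours v) (incident v) (\<lambda>e. opp e v). ?g1 \<sigma>)"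
        proof (rule Suc.IH)
          show "opp e v \<in> ends G e" if "e \<in> incident v" for e
            using that opp_props(1)[of e v] by (auto simp: incident_def)
          show "e \<in> edges G \<and> u \<in> ends G e \<and> ends G e \<inter> (W - neighbours v) = {}"
            if "(u, e) \<in> set (adj v)" for u e
            using that False by (auto simp: adj[OF v] neighbours_def)
          show "verts G \<subseteq> W - neighbours v \<union> set (v # S') \<union> fst ` set (adj v)"
            using Suc.prems(4) by (auto simp: nb Nil Cons)
        qed (use Suc.prems inc in \<open>auto simp: Cons\<close>)
        ultimately show ?thesis by simp
      qed
      have "A2 = constrained (insert v W) {} \<tau>"
        by (auto simp: A2_def A_def constrained_def)
      moreover have "real (card (constrained (insert v W) {} \<tau>)) * (1 - ?\<delta>2) \<le>
         ?N * (\<Sum>\<sigma>\<in>constrained (insert v W) {} \<tau>. ?g2 \<sigma>)"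
        by (rule Suc.IH) (use Suc.prems v in \<open>auto simp: Nil Cons\<close>)
      ultimately have 2: "real (card A2) * (1 - ?\<delta>2) \<le> ?N * (\<Sum>\<sigma>\<in>A2. ?g2 \<sigma>)" by simp
      have "(\<Sum>\<sigma>\<in>A. pmf (popping (Suc t) (\<sigma>, S, P)) x) =
        (\<Sum>\<sigma>\<in>A1. pmf (popping (Suc t) (\<sigma>, S, P)) x) + (\<Sum>\<sigma>\<in>A2. pmf (popping (Suc t) (\<sigma>, S, P)) x)"
        using AA by (simp add: sum.union_disjoint)
      also have "(\<Sum>\<sigma>\<in>A1. pmf (popping (Suc t) (\<sigma>, S, P)) x) = (\<Sum>\<sigma>\<in>A1. ?g1 \<sigma>)"
        by (intro sum.cong) (auto simp: A1_def Nil Cons bind_return_pmf)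
      also have "(\<Sum>\<sigma>\<in>A2. pmf (popping (Suc t) (\<sigma>, S, P)) x) = (\<Sum>\<sigma>\<in>A2. ?g2 \<sigma>)"
        by (intro sum.cong) (auto simp: A2_def Nil Cons bind_return_pmf)
      finally have "?N * (\<Sum>\<sigma>\<in>A. pmf (popping (Suc t) (\<sigma>, S, P)) x) \<ge>
        real (card A1) * (1 - ?\<delta>1) + real (card A2) * (1 - ?\<delta>2)"
        using 1 2 by (simp add: distrib_left)
      moreover have "real (card A1) * ?\<delta>1 + real (card A2) * ?\<delta>2 \<le> real (card A) * ?\<delta>"
      proof -
        define \<phi> where "\<phi> = (\<gamma> / \<beta>) ^ length S'"
        have \<phi>: "\<phi> > 0" "\<beta> ^ t > 0" "\<gamma> > 0" "\<beta> > 0" by (auto simp: \<phi>_def \<gamma>_def \<beta>_def)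
        have "real (card A1) * (\<gamma> ^ Suc d - 1) \<le> real (card A) * ((5 / 8) ^ d * (\<gamma> ^ Suc d - 1))"
          using mult_right_mono[OF A1_le, of "\<gamma> ^ Suc d - 1"]
          by (simp add: ac_simps \<gamma>_def one_le_power del: power_Suc)
        also have "\<dots> \<le> real (card A) * (\<gamma> / \<beta>\<^sup>2 - 1)"
          using degree_ge_3[OF v] by (intro mult_left_mono drift) (auto simp: d_def)
        finally have "real (card A1) * \<gamma> ^ Suc d + real (card A2) \<le> real (card A) * (\<gamma> / \<beta>\<^sup>2)"
          by (simp add: cardA algebra_simps)
        moreover have "real (card A1) * (\<gamma> ^ Suc d / \<beta>) \<le> real (card A1) * \<gamma> ^ Suc d"
          using \<beta>_gt_1 \<phi> by (intro mult_left_mono) (auto simp: field_simps simp del: power_Suc)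
        ultimately have *: "real (card A1) * (\<gamma> ^ Suc d / \<beta>) + real (card A2) \<le> real (card A) * (\<gamma> / \<beta>\<^sup>2)"
          by linarith
        have \<delta>: "?\<delta>1 = (\<gamma> ^ Suc d / \<beta>) * (\<phi> / \<beta> ^ t)" "?\<delta>2 = \<phi> / \<beta> ^ t" "?\<delta> = (\<gamma> / \<beta>\<^sup>2) * (\<phi> / \<beta> ^ t)"
          by (auto simp: potential_def \<phi>_def Nil Cons length_adj[OF v] d_def power2_eq_square)
        show ?thesis
          using mult_right_mono[OF *, of "\<phi> / \<beta> ^ t"] \<phi> unfolding \<delta>
          by (simp add: distrib_right mult.assoc add_divide_distrib)
      qed
      ultimately have "real (card A) * (1 - ?\<delta>) \<le> ?N * (\<Sum>\<sigma>\<in>A. pmf (popping (Suc t) (\<sigma>, S, P)) x)"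
        by (simp add: cardA algebra_simps)
      then show ?thesis by (simp add: A_def F)
    qed
  qed
qed

text \<open>\<open>tv_dist\<close> sums over orientations only, so the support is controlled
  separately.\<close>

lemma set_pmf_popping:
  assumes "\<sigma> \<in> orientations G" "set S \<subseteq> verts G" "\<And>u e. (u, e) \<in> set P \<Longrightarrow> e \<in> edges G \<and> u \<in> ends G e"
  shows "set_pmf (popping t (\<sigma>, S, P)) \<subseteq> orientations G"
  using assms
proof (induction t arbitrary: \<sigma> S P)
  case 0
  then show ?case by simp
next
  case (Suc t)
  show ?case
  proof (cases "(\<sigma>, S, P)" rule: pop_step.cases)
    case (1 \<sigma>' S' u e Q)
    then have e: "e \<in> edges G" "u \<in> ends G e" using Suc.prems(3)[of u e] by auto
    have "set_pmf (popping t (\<sigma>(e := x), u # S, Q)) \<subseteq> orientations G" if "x \<in> ends G e" for x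
      using 1 e that Suc.prems(2,3) ends_subset[OF e(1)]
      by (intro Suc.IH orientation_upd Suc.prems(1)) auto
    moreover have "opp e u \<in> ends G e" using opp_props(1)[OF e] by blast
    ultimately have "set_pmf (popping t (\<sigma>(e := if b then u else opp e u), u # S, Q)) \<subseteq> orientations G" for b
      using e(2) by (cases b) (simp_all only: if_True if_False)
    then show ?thesis using 1 by (simp add: UN_subset_iff)
  next
    case (2 \<sigma>' v S')
    then have v: "v \<in> verts G" using Suc.prems(2) by auto
    have "set_pmf (popping t (\<sigma>, S, adj v)) \<subseteq> orientations G"
      by (rule Suc.IH) (use Suc.prems(1,2) adj[OF v] in auto)
    moreover have "set_pmf (popping t (\<sigma>, S', [])) \<subseteq> orientations G"
      by (rule Suc.IH) (use Suc.prems(1,2) 2 in auto)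
    ultimately show ?thesis using 2 by (auto split: if_splits)
  next
    case (3 \<sigma>')
    then show ?thesis using Suc.IH[of \<sigma> S P] Suc.prems by auto
  qed
qed

text \<open>With \<open>W\<close> empty and all edges frozen, the constrained set is
  \<open>{\<sigma>}\<close>, and the averaged bound becomes one for this starting point. The entries
  of \<open>P\<close> name all vertices, so the stack may start empty.\<close>

lemma popping_close:
  assumes \<sigma>: "\<sigma> \<in> orientations G"
    and P: "\<And>u e. (u, e) \<in> set P \<Longrightarrow> e \<in> edges G \<and> u \<in> ends G e"
    and cover: "edges G \<subseteq> snd ` set P" "verts G \<subseteq> fst ` set P"
    and t: "\<gamma> ^ length P \<le> \<epsilon> * \<beta> ^ t"
  shows "tv_dist (orientations G) (popping t (\<sigma>, [], P)) (pmf_of_set (sink_free_orientations G)) \<le> \<epsilon>"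
proof (rule tv_dist_le_of_ge)
  show "finite (orientations G)" by simp
  let ?S = "sink_free_orientations G" and ?D = "popping t (\<sigma>, [], P)"
  have S: "finite ?S" "?S \<noteq> {}" "?S \<subseteq> orientations G"
    using sink_free_nonempty by (auto simp: sink_free_eq constrained_def)
  then show "set_pmf (pmf_of_set ?S) \<subseteq> orientations G" by simp
  have single: "constrained {} (edges G) \<sigma> = {\<sigma>}"
    using \<sigma> by (fastforce simp: constrained_def orientations_def intro: PiE_ext)
  have \<epsilon>: "potential ([] :: 'v list) P / \<beta> ^ t \<le> \<epsilon>"
    using t \<beta>_gt_1 by (simp add: potential_def divide_le_eq)
  fix x
  show "(1 - \<epsilon>) * pmf (pmf_of_set ?S) x \<le> pmf ?D x"
  proof (cases "x \<in> ?S")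
    case True
    have "1 - potential ([] :: 'v list) P / \<beta> ^ t \<le> real (card ?S) * pmf ?D x"
      using popping_lower_bound[of "edges G" P \<sigma> "{}" "[]" x t] True cover P
      by (simp add: single orientation_end[OF \<sigma>])
    with \<epsilon> have "1 - \<epsilon> \<le> real (card ?S) * pmf ?D x" by linarith
    then show ?thesis
      using True S by (simp add: pmf_of_set divide_le_eq mult.commute card_gt_0_iff)
  next
    case False
    then show ?thesis using S by (simp add: pmf_of_set)
  qed
qed

end

section \<open>The program\<close>

text \<open>A weakest-precondition style judgement joining halting under all flips with the law of
  the result. \<open>T\<close> is only an upper bound, so costs can be rounded up.\<close>

definition yields ::
  "nat \<Rightarrow> (memory \<Rightarrow> 'a) \<Rightarrow> config \<Rightarrow> nat \<Rightarrow> 'a pmf \<Rightarrow> bool" where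
  "yields w r cfg T D \<longleftrightarrow>
     (\<forall>c\<in>set_pmf (run w T cfg). fst c = []) \<and> map_pmf (r \<circ> snd) (run w T cfg) = D"

lemma yields_halted: "yields w r ([], s) T D \<longleftrightarrow> D = return_pmf (r s)"
  by (auto simp: yields_def run_halted)

lemma yields_step:
  assumes "0 < T"
  shows "yields w r (SKIP # cs, s) T D \<longleftrightarrow> yields w r (cs, s) (T - 1) D"
    and "yields w r (Assign x i a # cs, s) T D \<longleftrightarrow>
      yields w r (cs, upd s x (aval w i s) (aval w a s)) (T - 1) D"
    and "yields w r (Seq c d # cs, s) T D \<longleftrightarrow> yields w r (c # d # cs, s) (T - 1) D"
    and "yields w r (If b c d # cs, s) T D \<longleftrightarrow>
      yields w r ((if bval w b s then c else d) # cs, s) (T - 1) D"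
    and "yields w r (While b c # cs, s) T D \<longleftrightarrow>
      yields w r (if bval w b s then c # While b c # cs else cs, s) (T - 1) D"
  using assms by (cases T; simp add: yields_def bind_return_pmf)+

lemma yields_Flip:
  assumes "0 < T"
    and "yields w r (cs, upd s x (aval w i s) 1) (T - 1) (D True)"
    and "yields w r (cs, upd s x (aval w i s) 0) (T - 1) (D False)"
  shows "yields w r (Flip x i # cs, s) T (bind_pmf (bernoulli_pmf (1 / 2)) D)"
proof -
  obtain T' where T: "T = Suc T'" using assms(1) by (cases T) auto
  have *: "yields w r (cs, upd s x (aval w i s) (of_bool b)) T' (D b)" for b
    using assms(2,3) by (cases b) (simp_all add: T)
  have "map_pmf (r \<circ> snd) (run w T (Flip x i # cs, s)) =
     bind_pmf (bernoulli_pmf (1 / 2))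
       (\<lambda>b. map_pmf (r \<circ> snd) (run w T' (cs, upd s x (aval w i s) (of_bool b))))"
    by (simp add: T bind_map_pmf map_bind_pmf)
  with * show ?thesis
    by (simp add: yields_def T bind_map_pmf)
qed

lemma yields_mono:
  assumes "yields w r cfg T D" "T \<le> U"
  shows "yields w r cfg U D"
proof -
  have "run w U cfg = bind_pmf (run w T cfg) (run w (U - T))"
    using run_add[of w T "U - T"] assms(2) by simp
  also have "\<dots> = bind_pmf (run w T cfg) return_pmf"
    using assms(1) unfolding yields_def by (intro bind_pmf_cong) (auto simp: run_halted)
  finally show ?thesis using assms(1) by (simp add: yields_def bind_return_pmf')
qed

lemma upd_apply: "upd s x i k y = (if y = x then (s x)(i := k) else s y)"
  by (simp add: upd_def)

section \<open>The sampler as a machine program\<close>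

abbreviation "Var x \<equiv> Get x (N 0)"
abbreviation "SetVar x a \<equiv> Assign x (N 0) a"
abbreviation "Incr x i \<equiv> Assign x i (Plus (Get x i) (N 1))"
abbreviation "Decr x i \<equiv> Assign x i (Minus (Get x i) (N 1))"

fun block :: "com list \<Rightarrow> com" where
  "block [] = SKIP"
| "block (c # cs) = Seq c (block cs)"

text \<open>
  The array \<open>cnt\<close> holds the number of edges leaving each vertex and \<open>sum[e]\<close> the sum of the ends of
  the edge \<open>e\<close>, so that \<open>sum[e] - u\<close> is the end other than \<open>u\<close>.  The stack is \<open>stk\<close>, of height \<open>sp\<close>,
  and the adjacency entries from \<open>j\<close> to \<open>je - 1\<close> are those yet to be resampled; one iteration of the
  main loop treats one entry or one stack element, and the number \<open>f\<close> of remaining iterations is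
  fixed in advance.  As \<open>out\<close> is initially \<open>0\<close>, so that all edges seem to leave the vertex \<open>0\<close>, the
  counters start with \<open>cnt[0] = m\<close>.  The \<open>k\<close>-th digit of \<open>\<epsilon>\<close> is its first digit \<open>1\<close>.
\<close>

definition init_body :: com where
  "init_body = block
    [SetVar ''e'' (Get ''edge'' (Var ''j'')),
     SetVar ''u'' (Get ''nbr'' (Var ''j'')),
     Decr ''cnt'' (Get ''out'' (Var ''e'')),
     Assign ''out'' (Var ''e'') (Var ''u''),
     Incr ''cnt'' (Var ''u''),
     Assign ''sum'' (Var ''e'') (Plus (Get ''sum'' (Var ''e'')) (Var ''u'')),
     Incr ''j'' (N 0)]"

definition resample_body :: com where
  "resample_body = block
    [SetVar ''e'' (Get ''edge'' (Var ''j'')),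
     SetVar ''u'' (Get ''nbr'' (Var ''j'')),
     Decr ''cnt'' (Get ''out'' (Var ''e'')),
     Flip ''b'' (N 0),
     If (Less (Var ''b'') (N 1))
       (Assign ''out'' (Var ''e'') (Minus (Get ''sum'' (Var ''e'')) (Var ''u'')))
       (Assign ''out'' (Var ''e'') (Var ''u'')),
     Incr ''cnt'' (Get ''out'' (Var ''e'')),
     Assign ''stk'' (Var ''sp'') (Var ''u''),
     Incr ''sp'' (N 0),
     Incr ''j'' (N 0)]"

definition check_body :: com where
  "check_body = block
    [SetVar ''v'' (Get ''stk'' (Minus (Var ''sp'') (N 1))),
     If (Less (Get ''cnt'' (Var ''v'')) (N 1))
       (Seq (SetVar ''j'' (Get ''off'' (Var ''v'')))
         (SetVar ''je'' (Get ''off'' (Plus (Var ''v'') (N 1)))))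
       (Decr ''sp'' (N 0))]"

definition main_body :: com where
  "main_body = Seq (Decr ''f'' (N 0))
     (If (Less (Var ''j'') (Var ''je'')) resample_body
       (If (Less (N 0) (Var ''sp'')) check_body SKIP))"

definition main_loop :: com where
  "main_loop = While (Less (N 0) (Var ''f'')) main_body"

definition digit_loop :: com where
  "digit_loop = While (Less (Get ''eps'' (Var ''k'')) (N 1)) (Incr ''k'' (N 0))"

definition init_loop :: com where
  "init_loop = While (Less (Var ''j'') (Plus (Var ''m'') (Var ''m''))) init_body"

text \<open>The initial pass ends with \<open>j = 2 * m\<close>, so these assignments make the whole
  adjacency array pending. The factor 25000 is chosen for
  \<open>2 \<le> \<beta> ^ 25000\<close>.\<close>

definition popping_phase :: com where
  "popping_phase =
     Seq (SetVar ''f'' (Times (N 25000) (Plus (Var ''m'') (Var ''k''))))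
       (Seq (SetVar ''je'' (Var ''j'')) (Seq (SetVar ''j'' (N 0)) main_loop))"

definition sampler :: com where
  "sampler = Seq (SetVar ''k'' (N 1)) (Seq digit_loop
     (Seq (SetVar ''cnt'' (Var ''m'')) (Seq init_loop popping_phase)))"

section \<open>Adjacency lists\<close>

lemma concat_segment:
  assumes "v < length A"
  shows "take (length (A ! v)) (drop (\<Sum>u<v. length (A ! u)) (concat A)) = A ! v"
    and "(\<Sum>u<Suc v. length (A ! u)) \<le> length (concat A)"
proof -
  have A: "concat A = concat (take v A) @ A ! v @ concat (drop (Suc v) A)"
    by (metis assms concat.simps(2) concat_append id_take_nth_drop)
  have "length (concat (take v A)) = sum_list (map length (take v A))"
    by (simp add: length_concat)
  also have "\<dots> = (\<Sum>u<v. length (A ! u))"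
    using assms by (simp add: sum_list_sum_nth atLeast0LessThan)
  finally have len: "length (concat (take v A)) = (\<Sum>u<v. length (A ! u))" .
  show "take (length (A ! v)) (drop (\<Sum>u<v. length (A ! u)) (concat A)) = A ! v"
    by (subst A) (simp flip: len)
  show "(\<Sum>u<Suc v. length (A ! u)) \<le> length (concat A)"
    by (subst A) (simp flip: len)
qed

locale adj_list = min_degree_3 G for G :: "(nat, nat) mgraph" +
  fixes A :: adj_list
  assumes adj_list_of: "adj_list_of G A"
begin

abbreviation "n \<equiv> card (verts G)"
abbreviation "m \<equiv> card (edges G)"
abbreviation "L \<equiv> concat A"
abbreviation "offset v \<equiv> \<Sum>u<v. length (A ! u)"

lemma verts_iff: "v \<in> verts G \<longleftrightarrow> v < n" and edges_iff: "e \<in> edges G \<longleftrightarrow> e < m"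
  using adj_list_of unfolding adj_list_of_def by (metis lessThan_iff)+

lemma length_A: "length A = n"
  using adj_list_of unfolding adj_list_of_def by (elim conjE)

lemma adj_props: "\<forall>v\<in>verts G. distinct (A ! v) \<and>
    set (A ! v) = {(u, e). e \<in> edges G \<and> ends G e = {v, u}}"
  using adj_list_of unfolding adj_list_of_def by (elim conjE)

lemma set_adj: "v \<in> verts G \<Longrightarrow> set (A ! v) = {(u, e). e \<in> edges G \<and> ends G e = {v, u}}"
  and distinct_adj: "v \<in> verts G \<Longrightarrow> distinct (A ! v)"
  by (simp_all only: adj_props)

lemma length_adj: "v \<in> verts G \<Longrightarrow> length (A ! v) = degree G v"
proof -
  assume v: "v \<in> verts G"
  have "card (set (A ! v)) = card (incident v)"
  proof (rule bij_betw_same_card[of snd], rule bij_betw_imageI)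
    show "inj_on snd (set (A ! v))"
      unfolding set_adj[OF v] by (rule inj_onI) (auto simp: doubleton_eq_iff)
    show "snd ` set (A ! v) = incident v"
    proof (intro Set.equalityI subsetI)
      fix e assume "e \<in> incident v"
      then have "(opp e v, e) \<in> set (A ! v)"
        unfolding set_adj[OF v] using opp_props(1)[of e v] by (simp add: incident_def)
      then show "e \<in> snd ` set (A ! v)" by force
    qed (auto simp: set_adj[OF v] incident_def)
  qed
  then show ?thesis
    using distinct_card[OF distinct_adj[OF v]] by (simp add: degree_def incident_def)
qed

sublocale chain: adjacency G "(!) A"
  by unfold_locales (fact set_adj length_adj)+

lemma set_L: "set L = {(u, e). e \<in> edges G \<and> u \<in> ends G e}"
proof (intro Set.equalityI subsetI)
  fix p assume "p \<in> set L"
  then obtain xs where xs: "xs \<in> set A" "p \<in> set xs" by auto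
  then obtain v where v: "v < n" "xs = A ! v" unfolding in_set_conv_nth length_A by blast
  then have "v \<in> verts G" unfolding verts_iff by blast
  with xs v show "p \<in> {(u, e). e \<in> edges G \<and> u \<in> ends G e}"
    by (auto simp: set_adj)
next
  fix p assume "p \<in> {(u, e). e \<in> edges G \<and> u \<in> ends G e}"
  then obtain u e where p: "p = (u, e)" and e: "e \<in> edges G" "u \<in> ends G e" by auto
  then have v: "opp e u \<in> verts G" using ends_subset[OF e(1)] opp_props(1)[OF e] by blast
  have "ends G e = {opp e u, u}" using opp_props(1)[OF e] by auto
  then have "p \<in> set (A ! opp e u)" using e p by (simp add: set_adj[OF v])
  moreover have "A ! opp e u \<in> set A"
    using v verts_iff length_A by (metis nth_mem)
  ultimately show "p \<in> set L" by auto
qed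

lemma distinct_L: "distinct L"
proof (rule distinct_concat)
  have disj: "set (A ! i) \<inter> set (A ! j) = {}" if "i < n" "j < n" "i \<noteq> j" for i j
  proof -
    have v: "i \<in> verts G" "j \<in> verts G" using that by (simp_all only: verts_iff)
    show ?thesis using that(3) unfolding set_adj[OF v(1)] set_adj[OF v(2)]
      by (force simp: doubleton_eq_iff)
  qed
  \<comment> \<open>Disjoint lists coincide only if empty, which the degree bound excludes.\<close>
  have "A ! i \<noteq> []" if "i < n" for i
  proof -
    have v: "i \<in> verts G" using that by (simp only: verts_iff)
    show ?thesis using length_adj[OF v] degree_ge_3[OF v] by auto
  qed
  then have "A ! i \<noteq> A ! j" if "i < n" "j < n" "i \<noteq> j" for i j
    using that disj[of i j] by fastforce
  then show "distinct A"
    unfolding distinct_conv_nth length_A by blast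
  show "distinct ys" if "ys \<in> set A" for ys
  proof -
    from that obtain v where "v < n" "ys = A ! v" unfolding in_set_conv_nth length_A by blast
    then show ?thesis using distinct_adj[of v] verts_iff[of v] by blast
  qed
  show "set ys \<inter> set zs = {}" if "ys \<in> set A" "zs \<in> set A" "ys \<noteq> zs" for ys zs
  proof -
    from that obtain i j where "i < n" "j < n" "ys = A ! i" "zs = A ! j"
      unfolding in_set_conv_nth length_A by blast
    then show ?thesis using disj[of i j] that by blast
  qed
qed

lemma length_L: "length L = 2 * m"
proof -
  have "set L = prod.swap ` Sigma (edges G) (ends G)"
    unfolding set_L by auto
  then have "card (set L) = card (Sigma (edges G) (ends G))"
    by (simp add: card_image)
  also have "\<dots> = (\<Sum>e\<in>edges G. card (ends G e))"
    using ends_subset by (intro card_SigmaI) (auto intro: finite_subset[OF _ finite_verts])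
  also have "\<dots> = (\<Sum>e\<in>edges G. 2)" by (intro sum.cong) (auto simp: card_ends)
  finally show ?thesis using distinct_card[OF distinct_L] by simp
qed

lemma three_n_le: "3 * n \<le> 2 * m"
proof -
  have "3 * n = (\<Sum>v<n. 3)" by simp
  also have "\<dots> \<le> (\<Sum>v<n. length (A ! v))"
    by (intro sum_mono) (simp add: degree_ge_3 length_adj verts_iff)
  also have "\<dots> = length L"
    by (simp add: length_concat sum_list_sum_nth length_A atLeast0LessThan)
  finally show ?thesis by (simp add: length_L)
qed

lemma m_ge_3: "3 \<le> m"
proof -
  obtain v where v: "v \<in> verts G" using verts_nonempty by auto
  have "degree G v \<le> m" unfolding degree_def by (intro card_mono) auto
  with degree_ge_3[OF v] show ?thesis by simp
qed

text \<open>Each edge has exactly two entries, one naming each end; the initial pass thus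
  accumulates both ends in \<open>sum[e]\<close>.\<close>

lemma sum_ends:
  assumes "e \<in> edges G" "u \<in> ends G e"
  shows "sum_list (map fst (filter (\<lambda>p. snd p = e) L)) = u + opp e u"
proof -
  have "sum_list (map fst (filter (\<lambda>p. snd p = e) L)) = (\<Sum>p\<in>set (filter (\<lambda>p. snd p = e) L). fst p)"
    by (intro sum_list_distinct_conv_sum_set distinct_filter distinct_L)
  also have "set (filter (\<lambda>p. snd p = e) L) = {(u, e), (opp e u, e)}"
  proof -
    have ends: "a \<in> ends G e \<longleftrightarrow> a = u \<or> a = opp e u" for a
      unfolding opp_props(1)[OF assms] by (simp only: insert_iff empty_iff simp_thms)
    show ?thesis
      unfolding set_filter set_L using assms(1) by (auto simp: ends)
  qed
  also have "sum fst {(u, e), (opp e u, e)} = u + opp e u"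
    using opp_props(2)[OF assms] by simp
  finally show ?thesis .
qed

definition tail_count :: "(nat \<Rightarrow> nat) \<Rightarrow> nat \<Rightarrow> nat" where
  "tail_count f v = card {e \<in> edges G. f e = v}"

lemma tail_count_restrict: "tail_count (restrict f (edges G)) v = tail_count f v"
  unfolding tail_count_def by (rule arg_cong[where f = card]) auto

text \<open>Decrementing before incrementing is right even if the tail stays the same; the old tail
  has a positive count, so truncated subtraction is exact.\<close>

lemma tail_count_upd:
  assumes "e \<in> edges G"
  shows "tail_count (f(e := x)) = (let c = (tail_count f)(f e := tail_count f (f e) - 1) in c(x := c x + 1))"
proof -
  define r where "r v = card {e' \<in> edges G - {e}. f e' = v}" for v
  have "tail_count (f(e := y)) v = r v + (if v = y then 1 else 0)" for v y
  proof -
    have "{e' \<in> edges G. (f(e := y)) e' = v} =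
        {e' \<in> edges G - {e}. f e' = v} \<union> (if v = y then {e} else {})"
      using assms by auto
    then show ?thesis unfolding tail_count_def r_def by (simp add: card_Un_disjoint)
  qed
  from this[of x] this[of "f e"] show ?thesis
    by (auto simp: Let_def fun_eq_iff)
qed

lemma tail_count_le: "tail_count f v \<le> m"
  unfolding tail_count_def by (intro card_mono) auto

lemma is_sink_tail_count: "v \<in> verts G \<Longrightarrow> is_sink G f v \<longleftrightarrow> tail_count f v = 0"
  by (auto simp: is_sink_def tail_count_def)

section \<open>Memory invariants and simulation of the chain\<close>

definition input_arrays :: "memory \<Rightarrow> bool" where
  "input_arrays s \<longleftrightarrow> s ''off'' = cells (map offset [0..<n + 1]) \<and>
     s ''nbr'' = cells (map fst L) \<and> s ''edge'' = cells (map snd L) \<and> s ''m'' 0 = m"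

text \<open>An iteration pushes at most one vertex, so \<open>length S + t \<le> B\<close> is
  invariant; it keeps the stack height within a word.\<close>

definition represents :: "nat \<Rightarrow> nat \<Rightarrow> (nat, nat) popping_state \<Rightarrow> memory \<Rightarrow> bool" where
  "represents B t = (\<lambda>(\<sigma>, S, P) s. input_arrays s \<and>
     (\<forall>u e. e \<in> edges G \<longrightarrow> u \<in> ends G e \<longrightarrow> s ''sum'' e = u + opp e u) \<and>
     read_orientation G s = \<sigma> \<and> \<sigma> \<in> orientations G \<and> s ''cnt'' = tail_count (s ''out'') \<and>
     map (s ''stk'') [0..<length S] = rev S \<and> s ''sp'' 0 = length S \<and> set S \<subseteq> verts G \<and>
     length S + t \<le> B \<and> s ''f'' 0 = t \<and> s ''j'' 0 \<le> s ''je'' 0 \<and> s ''je'' 0 \<le> length L \<and>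
     P = take (s ''je'' 0 - s ''j'' 0) (drop (s ''j'' 0) L))"

section \<open>Correctness of the program\<close>



lemma cells_offset: "v \<le> n \<Longrightarrow> cells (map offset [0..<n + 1]) v = offset v"
  by (simp add: cells_def del: upt_Suc)

text \<open>One iteration simulates one step of the chain, idle steps included; \<open>cont\<close>
  acts as the postcondition, and 30 is a generous bound for the longest branch.\<close>

lemma main_body_yields:
  assumes "represents B (Suc t) a s" "B + 2 * m < 2 ^ w"
    and cont: "\<And>a' s'. a' \<in> set_pmf (chain.pop_step a) \<Longrightarrow> represents B t a' s' \<Longrightarrow>
       yields w (read_orientation G) (cs, s') T (chain.popping t a')"
  shows "yields w (read_orientation G) (main_body # cs, s) (T + 30) (chain.popping (Suc t) a)"
proof -
  obtain \<sigma> S P where a: "a = (\<sigma>, S, P)" by (cases a)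
  have small: "(k::nat) mod 2 ^ w = k" if "k \<le> B + 2 * m" for k
    using that assms(2) by simp
  have w: "0 < w" using assms(2) m_ge_3 by (cases w) auto
  have one: "Suc 0 mod 2 ^ w = Suc 0" using small[of 1] m_ge_3 by simp
  note R = assms(1)[unfolded a represents_def prod.case input_arrays_def]
  note defs = represents_def input_arrays_def main_body_def resample_body_def check_body_def
  show ?thesis
  proof (cases P)
    case (Cons ue Q)
    obtain u e where ue: "ue = (u, e)" by (cases ue)
    define j where "j = s ''j'' 0"
    have P: "(u, e) # Q = take (s ''je'' 0 - j) (drop j L)" "s ''je'' 0 \<le> length L"
      using R unfolding Cons ue j_def by auto
    then have j: "j < s ''je'' 0" "j < length L"
      by (auto intro: ccontr simp: not_less)
    have "s ''je'' 0 - j = Suc (s ''je'' 0 - Suc j)" using j by simp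
    then have Lj: "L ! j = (u, e)" "Q = take (s ''je'' 0 - Suc j) (drop (Suc j) L)"
      using P(1) unfolding Cons_nth_drop_Suc[OF j(2), symmetric] by simp_all
    have e: "e \<in> edges G" "u \<in> ends G e"
      using nth_mem[OF j(2)] unfolding Lj(1) set_L by auto
    have opp: "opp e u \<in> ends G e" using opp_props(1)[OF e] by blast
    have uv: "u \<in> verts G" using ends_subset e by auto
    have val: "s ''j'' 0 = j" "s ''sp'' 0 = length S" "s ''f'' 0 = Suc t" "s ''sum'' e = u + opp e u"
      "s ''cnt'' = tail_count (s ''out'')"
      using R e by (simp_all add: j_def)
    have edge: "s ''edge'' j = e" "s ''nbr'' j = u"
      using R j Lj by (auto simp: cells_def)
    have "chain.popping (Suc t) a = bind_pmf (bernoulli_pmf (1 / 2))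
       (\<lambda>b. chain.popping t (\<sigma>(e := if b then u else opp e u), u # S, Q))"
      by (simp add: a Cons ue bind_map_pmf)
    have step: "yields w (read_orientation G) (cs, s') T (chain.popping t (\<sigma>(e := y), u # S, Q))"
      if y: "y \<in> ends G e" and s': "s' ''off'' = s ''off''" "s' ''nbr'' = s ''nbr''" "s' ''edge'' = s ''edge''"
        "s' ''m'' = s ''m''" "s' ''sum'' = s ''sum''" "s' ''je'' 0 = s ''je'' 0" "s' ''f'' 0 = t"
        "s' ''j'' 0 = Suc j" "s' ''out'' = (s ''out'')(e := y)" "s' ''cnt'' = tail_count ((s ''out'')(e := y))"
        "s' ''sp'' 0 = Suc (length S)" "s' ''stk'' = (s ''stk'')(length S := u)" for y s'
    proof (rule cont)
      show "(\<sigma>(e := y), u # S, Q) \<in> set_pmf (chain.pop_step a)"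
        using y opp_props(1)[OF e] by (auto simp: a Cons ue)
      show "represents B t (\<sigma>(e := y), u # S, Q) s'"
        using R s' y e uv j Lj unfolding represents_def input_arrays_def prod.case
        by (auto simp: read_orientation_def orientation_upd)
    qed
    have B: "Suc (length S + t) \<le> B" using R by (elim conjE) simp
    have mods: "Suc j mod 2 ^ w = Suc j" "Suc (length S) mod 2 ^ w = Suc (length S)"
      "Suc (tail_count f v) mod 2 ^ w = Suc (tail_count f v)"
      "Suc (tail_count f v - Suc 0) mod 2 ^ w = Suc (tail_count f v - Suc 0)" for f v
      using B j length_L tail_count_le[of f v] by (intro small; linarith)+
    have "yields w (read_orientation G) (main_body # cs, s) (T + 30) (bind_pmf (bernoulli_pmf (1 / 2))
       (\<lambda>b. chain.popping t (\<sigma>(e := if b then u else opp e u), u # S, Q)))"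
      \<comment> \<open>Symbolic execution up to the flip; both outcomes then run through the
        remaining code towards \<open>step\<close>.\<close>
      apply (simp add: main_body_def resample_body_def yields_step one upd_apply val j edge w)
      apply (rule yields_Flip)
        apply simp
       apply (simp add: yields_step one upd_apply val j edge w split del: if_split)
       apply (rule yields_mono[OF step])
       apply (simp_all add: upd_apply e opp tail_count_upd Let_def fun_eq_iff mods val
           split del: if_split)
       apply (simp_all add: mods)
       apply (simp add: yields_step one upd_apply val j edge w split del: if_split)
       apply (rule yields_mono[OF step])
       apply (simp_all add: upd_apply e opp tail_count_upd Let_def fun_eq_iff mods val
           split del: if_split)
       apply (simp_all add: mods)
      done
    then show ?thesis
      unfolding \<open>chain.popping (Suc t) a = _\<close> .
  next
    case Nil
    then have jje: "s ''j'' 0 = s ''je'' 0" using R by auto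
    have val: "s ''sp'' 0 = length S" "s ''f'' 0 = Suc t" "s ''cnt'' = tail_count (s ''out'')"
      using R by simp_all
    show ?thesis
    proof (cases S)
      case Nil': Nil
      have "yields w (read_orientation G) (main_body # cs, s) (T + 30) (chain.popping t a)"
        apply (simp add: main_body_def yields_step one upd_apply jje val Nil' w)
        apply (rule yields_mono[OF cont])
          apply (simp add: a Nil Nil')
         apply (use R in \<open>simp add: represents_def input_arrays_def a upd_apply read_orientation_def\<close>)
        apply simp
        done
      then show ?thesis by (simp add: a Nil Nil' bind_return_pmf)
    next
      case Cons: (Cons v S')
      have v: "v \<in> verts G" "v < n" using R Cons verts_iff by auto
      have "map (s ''stk'') [0..<length S] ! length S' = rev S ! length S'" using R by simp
      then have stk: "s ''stk'' (length S') = v" by (simp add: Cons nth_append)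
      have stk': "map (s ''stk'') [0..<length S'] = rev S'" using R by (simp add: Cons)
      have sv: "Suc v mod 2 ^ w = Suc v" using small[of "Suc v"] v three_n_le by simp
      have "v < length A" using v length_A by simp
      note seg = concat_segment[OF this]
      have offs: "s ''off'' v = offset v" "s ''off'' (Suc v) = offset (Suc v)"
        using R v cells_offset[of v] cells_offset[of "Suc v"] by (simp_all del: upt_Suc sum.lessThan_Suc)
      have sink: "is_sink G \<sigma> v \<longleftrightarrow> tail_count (s ''out'') v = 0"
        using R is_sink_tail_count[OF v(1), of \<sigma>] tail_count_restrict[of "s ''out''" v]
        by (auto simp: read_orientation_def)
      have "yields w (read_orientation G) (main_body # cs, s) (T + 30)
          (chain.popping t (if is_sink G \<sigma> v then (\<sigma>, v # S', A ! v) else (\<sigma>, S', [])))"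
      proof (cases "is_sink G \<sigma> v")
        case True
        then show ?thesis
          apply (simp add: main_body_def check_body_def yields_step one upd_apply jje val Cons w stk
              offs sv sink)
          apply (rule yields_mono[OF cont])
            apply (simp add: a Nil Cons sink)
           apply (use R seg Cons stk' jje in
              \<open>simp add: represents_def input_arrays_def a upd_apply read_orientation_def\<close>)
          apply simp
          done
      next
        case False
        then show ?thesis
          apply (simp add: main_body_def check_body_def yields_step one upd_apply jje val Cons w stk
              offs sv sink)
          apply (rule yields_mono[OF cont])
            apply (simp add: a Nil Cons sink)
           apply (use R seg Cons stk' jje in
              \<open>simp add: represents_def input_arrays_def a upd_apply read_orientation_def\<close>)
          apply simp
          done
      qed
      then show ?thesis by (simp add: a Nil Cons bind_return_pmf)
    qed
  qed
qed

lemma main_loop_yields: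
  assumes "represents B t a s" "B + 2 * m < 2 ^ w"
  shows "yields w (read_orientation G) ([main_loop], s) (31 * t + 1) (chain.popping t a)"
  using assms(1)
proof (induction t arbitrary: a s)
  case 0
  then show ?case
    by (simp add: main_loop_def yields_step yields_halted represents_def split: prod.splits)
next
  case (Suc t)
  have "s ''f'' 0 = Suc t" using Suc.prems by (simp add: represents_def split: prod.splits)
  moreover have "yields w (read_orientation G) (main_body # [main_loop], s) (31 * t + 1 + 30)
      (chain.popping (Suc t) a)"
    using Suc.prems assms(2) by (rule main_body_yields) (rule Suc.IH)
  ultimately show ?case
    unfolding main_loop_def by (simp add: yields_step)
qed

section \<open>The initial pass over the adjacency array\<close>

lemma ex_yields_mono:
  "\<exists>D. Q D \<and> yields w r cfg T D \<Longrightarrow> T \<le> U \<Longrightarrow> \<exists>D. Q D \<and> yields w r cfg U D"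
  using yields_mono by metis

text \<open>The counters include unvisited edges, whose recorded tail 0 need not be an end; only
  visited edges are known to have a genuine tail.\<close>

definition initialised :: "nat \<Rightarrow> nat \<Rightarrow> memory \<Rightarrow> bool" where
  "initialised K j s \<longleftrightarrow> input_arrays s \<and> s ''cnt'' = tail_count (s ''out'') \<and>
     (\<forall>e\<in>snd ` set (take j L). s ''out'' e \<in> ends G e) \<and>
     (\<forall>e. s ''sum'' e = sum_list (map fst (filter (\<lambda>p. snd p = e) (take j L)))) \<and>
     s ''j'' 0 = j \<and> s ''k'' 0 = K \<and> s ''sp'' 0 = 0"

text \<open>The orientation left by the pass depends on the order of the lists, so the output law is
  only asserted to exist with a property \<open>Q\<close>.\<close>

lemma init_step:
  assumes "initialised K j s" "j < length L" "3 * m < 2 ^ w"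
    and cont: "\<And>s'. initialised K (Suc j) s' \<Longrightarrow> \<exists>D. Q D \<and> yields w r (cs, s') T D"
  shows "\<exists>D. Q D \<and> yields w r (init_body # cs, s) (T + 15) D"
proof -
  obtain u e where Lj: "L ! j = (u, e)" by (cases "L ! j")
  have e: "e \<in> edges G" "u \<in> ends G e"
    using nth_mem[OF assms(2)] unfolding Lj set_L by auto
  then have u: "u < n" using ends_subset[of e] verts_iff[of u] by auto
  have opp: "opp e u < n"
    using e opp_props(1)[of e u] ends_subset[of e] verts_iff[of "opp e u"] by auto
  have small: "(k::nat) mod 2 ^ w = k" if "k \<le> 3 * m" for k
    using that assms(3) by simp
  have one: "Suc 0 mod 2 ^ w = Suc 0" and w: "0 < w" using small[of 1] m_ge_3 by (auto intro: ccontr)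
  note R = assms(1)[unfolded initialised_def input_arrays_def]
  have edge: "s ''edge'' j = e" "s ''nbr'' j = u"
    using R assms(2) Lj by (auto simp: cells_def)
  have val: "s ''j'' 0 = j" "s ''cnt'' = tail_count (s ''out'')" using R by simp_all
  have take: "take (Suc j) L = take j L @ [(u, e)]"
    using take_Suc_conv_app_nth[OF assms(2)] Lj by simp
  \<comment> \<open>A prefix contributes at most the full sum of the two ends, so the addition does
    not overflow.\<close>
  have "take j L @ (u, e) # drop (Suc j) L = L"
    using id_take_nth_drop[OF assms(2)] Lj by simp
  then have "sum_list (map fst (filter (\<lambda>p. snd p = e) (take j L @ (u, e) # drop (Suc j) L))) = u + opp e u"
    using sum_ends[OF e] by (simp only:)
  then have "s ''sum'' e + u \<le> u + opp e u"
    using R by simp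
  then have sum: "(s ''sum'' e + u) mod 2 ^ w = s ''sum'' e + u"
    using u opp three_n_le by (intro small) linarith
  have mods: "Suc j mod 2 ^ w = Suc j"
    "Suc (tail_count f v) mod 2 ^ w = Suc (tail_count f v)"
    "Suc (tail_count f v - Suc 0) mod 2 ^ w = Suc (tail_count f v - Suc 0)" for f v
    using assms(2) length_L tail_count_le[of f v] m_ge_3 by (intro small; linarith)+
  have step: "\<exists>D. Q D \<and> yields w r (cs, s') T D"
    if s': "s' ''off'' = s ''off''" "s' ''nbr'' = s ''nbr''" "s' ''edge'' = s ''edge''"
      "s' ''m'' = s ''m''" "s' ''sum'' = (s ''sum'')(e := s ''sum'' e + u)" "s' ''k'' = s ''k''"
      "s' ''sp'' = s ''sp''"
      "s' ''j'' 0 = Suc j" "s' ''out'' = (s ''out'')(e := u)" "s' ''cnt'' = tail_count ((s ''out'')(e := u))" for s'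
    by (rule cont) (use R s' e in \<open>simp add: initialised_def input_arrays_def take del: upt_Suc\<close>)
  show ?thesis
    apply (simp add: init_body_def yields_step one upd_apply val edge w split del: if_split)
    apply (rule ex_yields_mono[OF step])
    apply (simp_all add: upd_apply e tail_count_upd Let_def fun_eq_iff mods val sum split del: if_split)
    apply (simp_all add: mods)
    done
qed

lemma init_loop_yields:
  assumes "initialised K j s" "j \<le> length L" "3 * m < 2 ^ w"
    and cont: "\<And>s'. initialised K (length L) s' \<Longrightarrow> \<exists>D. Q D \<and> yields w r (cs, s') T D"
  shows "\<exists>D. Q D \<and> yields w r (init_loop # cs, s) (T + 16 * (length L - j) + 1) D"
  using assms(1,2)
proof (induction "length L - j" arbitrary: j s)
  case 0
  then have j: "j = length L" by simp
  have "(m + m) mod 2 ^ w = length L" using assms(3) length_L by simp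
  moreover have "s ''j'' 0 = j" "s ''m'' 0 = m"
    using "0.prems" by (simp_all add: initialised_def input_arrays_def)
  ultimately show ?case
    using cont "0.prems" j by (simp add: init_loop_def yields_step)
next
  case (Suc d)
  then have j: "j < length L" by simp
  have "(m + m) mod 2 ^ w = length L" using assms(3) length_L by simp
  moreover have "s ''j'' 0 = j" "s ''m'' 0 = m"
    using Suc.prems by (simp_all add: initialised_def input_arrays_def)
  moreover have "\<exists>D. Q D \<and> yields w r (init_body # init_loop # cs, s) (T + 16 * (length L - Suc j) + 1 + 15) D"
    using Suc j by (intro init_step[OF Suc.prems(1) j assms(3)] Suc.hyps(1)) auto
  moreover have "T + 16 * (length L - j) + 1 = Suc (T + 16 * (length L - Suc j) + 1 + 15)"
    using j by simp
  ultimately show ?case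
    using j unfolding init_loop_def
    by (simp only: yields_step(5)[OF zero_less_Suc]) (simp add: length_L)
qed

end

section \<open>The magnitude of \<epsilon> and the fuel it requires\<close>

lemma digit_loop_yields:
  assumes "1 \<le> j" "j \<le> K" "K < 2 ^ w" "0 < w"
    and "\<And>i. 1 \<le> i \<Longrightarrow> i < K \<Longrightarrow> s ''eps'' i = 0" "s ''eps'' K = 1"
    and cont: "yields w r (cs, upd s ''k'' 0 K) T D"
  shows "yields w r (digit_loop # cs, upd s ''k'' 0 j)
    (T + 2 * (K - j) + 1) D"
  using assms(1,2)
proof (induction "K - j" arbitrary: j)
  case 0
  then have "j = K" by simp
  moreover have "upd s ''k'' 0 K ''k'' 0 = K" "upd s ''k'' 0 K ''eps'' = s ''eps''"
    by (simp_all add: upd_def)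
  ultimately show ?case using assms(4,6) cont by (simp add: digit_loop_def yields_step)
next
  case (Suc d)
  then have j: "1 \<le> j" "j < K" by simp_all
  have "upd s ''k'' 0 j ''k'' 0 = j" "upd s ''k'' 0 j ''eps'' = s ''eps''"
    "upd (upd s ''k'' 0 j) ''k'' 0 (Suc j) = upd s ''k'' 0 (Suc j)" by (simp_all add: upd_def)
  moreover have "Suc j mod 2 ^ w = Suc j" "Suc 0 mod 2 ^ w = Suc 0"
    using j assms(3,4) by simp_all
  moreover have "s ''eps'' j = 0" using j assms by simp
  moreover have "T + 2 * (K - j) + 1 = Suc (Suc (T + 2 * (K - Suc j) + 1))" using j by simp
  moreover have "yields w r (digit_loop # cs, upd s ''k'' 0 (Suc j))
    (T + 2 * (K - Suc j) + 1) D"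
    using Suc j by (intro Suc.hyps(1)) auto
  ultimately show ?case
    using assms(4) unfolding digit_loop_def by (simp add: yields_step)
qed

text \<open>The least \<open>K\<close> with \<open>1 \<le> \<epsilon> * 2 ^ K\<close> works:
  minimality bounds this product by 2 and makes all earlier floors vanish. So \<open>2 ^ K\<close>
  is \<open>1 / \<epsilon>\<close> up to a factor 2.\<close>

lemma first_digit:
  fixes \<epsilon> :: real
  assumes "0 < \<epsilon>" "\<epsilon> < 1"
  obtains K where "1 \<le> K" "1 \<le> \<epsilon> * 2 ^ K" "\<epsilon> * 2 ^ K < 2" "\<lfloor>\<epsilon> * 2 ^ K\<rfloor> = 1"
    "\<And>k. k < K \<Longrightarrow> \<lfloor>\<epsilon> * 2 ^ k\<rfloor> = 0"
proof -
  obtain k where "1 / \<epsilon> < 2 ^ k" using real_arch_pow[of 2 "1 / \<epsilon>"] by auto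
  then have ex: "1 \<le> \<epsilon> * 2 ^ k" using assms by (simp add: field_simps)
  define K where "K = (LEAST k. 1 \<le> \<epsilon> * 2 ^ k)"
  have K: "1 \<le> \<epsilon> * 2 ^ K" unfolding K_def using ex by (rule LeastI)
  have less: "\<epsilon> * 2 ^ k < 1" if "k < K" for k
    using not_less_Least[of k "\<lambda>k. 1 \<le> \<epsilon> * 2 ^ k"] that unfolding K_def by simp
  have K1: "1 \<le> K" using K assms by (cases K) auto
  have K2: "\<epsilon> * 2 ^ K < 2" using less[of "K - 1"] K1 by (cases K) auto
  show ?thesis
    using K1 K K2 less assms by (intro that[of K]) (auto simp: floor_eq_iff)
qed

text \<open>Bernoulli's inequality gives \<open>2 \<le> \<beta> ^ 25000\<close>. The part
  \<open>m\<close> of the fuel absorbs the initial potential, as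
  \<open>\<gamma>\<^sup>2 \<le> 2\<close>, and the part \<open>K\<close> provides the factor
  \<epsilon>.\<close>

lemma fuel_suffices:
  assumes "1 \<le> \<epsilon> * 2 ^ K"
  shows "\<gamma> ^ (2 * m) \<le> \<epsilon> * \<beta> ^ (25000 * (m + K))"
proof -
  have "1 + real 25000 * (1 / 25000) \<le> (1 + 1 / 25000 :: real) ^ 25000"
    by (rule Bernoulli_inequality) simp
  then have \<beta>: "2 \<le> \<beta> ^ 25000" by (simp add: \<beta>_def)
  have "\<gamma> ^ (2 * m) = (\<gamma>\<^sup>2) ^ m" by (simp add: power_mult)
  also have "\<dots> \<le> 2 ^ m" by (intro power_mono) (simp_all add: \<gamma>_def power2_eq_square)
  also have "\<dots> \<le> 2 ^ m * (\<epsilon> * 2 ^ K)" using assms by simp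
  also have "\<dots> = \<epsilon> * 2 ^ (m + K)" by (simp add: power_add)
  also have "\<dots> \<le> \<epsilon> * (\<beta> ^ 25000) ^ (m + K)"
  proof (intro mult_left_mono power_mono \<beta>)
    show "0 \<le> \<epsilon>" using assms by (smt (verit) mult_nonneg_nonneg mult_neg_pos zero_less_power)
  qed simp
  finally show ?thesis by (simp only: power_mult)
qed

section \<open>Correctness of the whole sampler\<close>

context adj_list
begin

lemma edges_covered: "edges G \<subseteq> snd ` set L"
proof
  fix e assume e: "e \<in> edges G"
  then have "ends G e \<noteq> {}" using card_ends by fastforce
  then obtain u where "u \<in> ends G e" by blast
  with e have "(u, e) \<in> set L" unfolding set_L by simp
  then show "e \<in> snd ` set L" by force
qed

lemma popping_orientation_close:
  assumes "\<sigma> \<in> orientations G" "1 \<le> \<epsilon> * 2 ^ K"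
  shows "set_pmf (chain.popping (25000 * (m + K)) (\<sigma>, [], L)) \<subseteq> orientations G"
    and "tv_dist (orientations G) (chain.popping (25000 * (m + K)) (\<sigma>, [], L))
      (pmf_of_set (sink_free_orientations G)) \<le> \<epsilon>"
proof -
  have L: "e \<in> edges G \<and> u \<in> ends G e" if "(u, e) \<in> set L" for u e
    using that unfolding set_L by simp
  show "set_pmf (chain.popping (25000 * (m + K)) (\<sigma>, [], L)) \<subseteq> orientations G"
    using assms(1) L by (intro chain.set_pmf_popping) auto
  show "tv_dist (orientations G) (chain.popping (25000 * (m + K)) (\<sigma>, [], L))
      (pmf_of_set (sink_free_orientations G)) \<le> \<epsilon>"
  proof (rule chain.popping_close[OF assms(1) L])
    show "edges G \<subseteq> snd ` set L" by (rule edges_covered)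
    show "verts G \<subseteq> fst ` set L"
    proof
      fix v assume v: "v \<in> verts G"
      then have "{e \<in> edges G. v \<in> ends G e} \<noteq> {}"
        using degree_ge_3[OF v] unfolding degree_def by (metis card.empty not_numeral_le_zero)
      then obtain e where "(v, e) \<in> set L" unfolding set_L by auto
      then show "v \<in> fst ` set L" by force
    qed
    show "\<gamma> ^ length L \<le> \<epsilon> * \<beta> ^ (25000 * (m + K))"
      unfolding length_L using assms(2) by (rule fuel_suffices)
  qed
qed

lemma sampler_correct:
  assumes K: "1 \<le> K" "1 \<le> \<epsilon> * 2 ^ K" "\<lfloor>\<epsilon> * 2 ^ K\<rfloor> = 1" "\<And>k. k < K \<Longrightarrow> \<lfloor>\<epsilon> * 2 ^ k\<rfloor> = 0"
    and word: "25000 * (m + K) + 3 * m < 2 ^ w"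
  shows "\<exists>D. (set_pmf D \<subseteq> orientations G \<and>
      tv_dist (orientations G) D (pmf_of_set (sink_free_orientations G)) \<le> \<epsilon>) \<and>
    yields w (read_orientation G) ([sampler], input_memory G A \<epsilon>)
      (31 * (25000 * (m + K)) + 32 * m + 2 * K + 50) D" (is "\<exists>D. ?Q D \<and> _")
proof -
  let ?F = "25000 * (m + K)" and ?r = "read_orientation G"
  have small: "(k::nat) mod 2 ^ w = k" if "k \<le> ?F + 3 * m" for k
    using that word by simp
  have one: "Suc 0 mod 2 ^ w = Suc 0" and w: "0 < w" using small[of 1] m_ge_3 by (auto intro: ccontr)
  have F: "(25000 mod 2 ^ w * ((m + K) mod 2 ^ w)) mod 2 ^ w = ?F"
    using small[of 25000] small[of "m + K"] small[of ?F] K(1) by simp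
  have mK: "K < 2 ^ w" "3 * m < 2 ^ w" "?F + 2 * m < 2 ^ w" using word by simp_all
  have main: "\<exists>D. ?Q D \<and> yields w ?r ([popping_phase], s') (31 * ?F + 10) D"
    if s': "initialised K (length L) s'" for s'
  proof -
    define \<sigma> where "\<sigma> = read_orientation G s'"
    have \<sigma>: "\<sigma> \<in> orientations G"
      using s' edges_covered
      by (auto simp: \<sigma>_def read_orientation_def orientations_def initialised_def)
    have val: "s' ''m'' 0 = m" "s' ''k'' 0 = K" "s' ''j'' 0 = length L"
      using s' by (simp_all add: initialised_def input_arrays_def)
    have "yields w ?r ([popping_phase], s') (31 * ?F + 10) (chain.popping ?F (\<sigma>, [], L))"
      apply (simp add: popping_phase_def yields_step upd_apply val F
          del: distrib_left_numeral add_mult_distrib2)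
      apply (rule yields_mono[OF main_loop_yields[OF _ mK(3)]])
      subgoal
        using s' \<sigma> sum_ends unfolding represents_def
        by (auto simp: initialised_def input_arrays_def upd_apply \<sigma>_def read_orientation_def)
      apply simp
      done
    with popping_orientation_close[OF \<sigma> K(2)] show ?thesis by blast
  qed
  define s0 where "s0 = input_memory G A \<epsilon>"
  have "initialised K 0 (upd (upd s0 ''k'' 0 K) ''cnt'' 0 m)"
    by (auto simp: initialised_def input_arrays_def s0_def upd_apply input_memory_def cells_def
        tail_count_def fun_eq_iff length_A)
  from init_loop_yields[OF this _ mK(2) main]
  obtain D where D: "?Q D" "yields w ?r ([init_loop, popping_phase], upd (upd s0 ''k'' 0 K) ''cnt'' 0 m)
      (31 * ?F + 10 + 16 * (2 * m) + 1) D"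
    by (auto simp: length_L)
  have s0: "upd s0 ''k'' 0 K ''m'' 0 = m" by (simp add: s0_def upd_apply input_memory_def cells_def)
  have "yields w ?r
     ([digit_loop, Seq (SetVar ''cnt'' (Var ''m'')) (Seq init_loop popping_phase)], upd s0 ''k'' 0 1)
     (31 * ?F + 10 + 16 * (2 * m) + 1 + 3 + 2 * (K - 1) + 1) D"
  proof (rule digit_loop_yields)
    show "s0 ''eps'' i = 0" if "1 \<le> i" "i < K" for i
      using K(4)[OF that(2)] by (simp add: s0_def input_memory_def)
    show "s0 ''eps'' K = 1"
      using K(3) by (simp add: s0_def input_memory_def)
    show "yields w ?r ([Seq (SetVar ''cnt'' (Var ''m'')) (Seq init_loop popping_phase)], upd s0 ''k'' 0 K)
       (31 * ?F + 10 + 16 * (2 * m) + 1 + 3) D"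
      using D(2) by (simp add: yields_step s0)
  qed (use K(1) mK w in auto)
  then have "yields w ?r ([sampler], s0) (31 * ?F + 10 + 16 * (2 * m) + 1 + 3 + 2 * (K - 1) + 1 + 3) D"
    using w by (simp add: sampler_def yields_step one)
  then have "yields w ?r ([sampler], s0) (31 * ?F + 32 * m + 2 * K + 50) D"
    by (rule yields_mono) simp
  with D(1) show ?thesis unfolding s0_def by blast
qed

end

theorem theorem1p2:
  shows "\<exists>(prog :: com) (C :: real) (c :: real).
    \<forall>(G :: (nat, nat) mgraph) (A :: adj_list) (\<epsilon> :: real) (w :: nat).
      multigraph G \<longrightarrow> (\<forall>v\<in>verts G. 3 \<le> degree G v) \<longrightarrow> adj_list_of G A \<longrightarrow>
      0 < \<epsilon> \<longrightarrow> \<epsilon> < 1 \<longrightarrow>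
      c * log 2 (real (card (edges G)) / \<epsilon>) \<le> real w \<longrightarrow>
      (\<exists>T :: nat.
         real T \<le> C * (real (card (edges G)) * ln (real (card (edges G)) / \<epsilon>)) \<and>
         halts_within w prog (input_memory G A \<epsilon>) T \<and>
         set_pmf (output_dist w prog G A \<epsilon> T) \<subseteq> orientations G \<and>
         tv_dist (orientations G) (output_dist w prog G A \<epsilon> T)
           (pmf_of_set (sink_free_orientations G)) \<le> \<epsilon>)"
\<comment> \<open>Let \<open>x = m / \<epsilon>\<close>, which is at least 3. The 12 comes from
  \<open>50003 < 3 ^ 11\<close>, so that \<open>50003 * x < x ^ 12\<close>. The time constant
  exceeds \<open>2 * 775002 + 775032 + 50\<close>, by way of \<open>K \<le> 2 * ln x\<close> and
  \<open>1 \<le> ln x\<close>.\<close>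
proof (rule exI[of _ sampler], rule exI[of _ 3000000], rule exI[of _ 12], intro allI impI)
  fix G :: "(nat, nat) mgraph" and A :: adj_list and \<epsilon> :: real and w :: nat
  assume G: "multigraph G" "\<forall>v\<in>verts G. 3 \<le> degree G v" "adj_list_of G A"
    and \<epsilon>: "0 < \<epsilon>" "\<epsilon> < 1" and w: "12 * log 2 (real (card (edges G)) / \<epsilon>) \<le> real w"
  interpret adj_list G A by unfold_locales (use G in auto)
  obtain K where K: "1 \<le> K" "1 \<le> \<epsilon> * 2 ^ K" "\<epsilon> * 2 ^ K < 2" "\<lfloor>\<epsilon> * 2 ^ K\<rfloor> = 1"
    "\<And>k. k < K \<Longrightarrow> \<lfloor>\<epsilon> * 2 ^ k\<rfloor> = 0"
    using first_digit[OF \<epsilon>] by blast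
  define x where "x = real m / \<epsilon>"
  have x: "3 \<le> x" "real m \<le> x" "1 / \<epsilon> \<le> x / 3"
    using m_ge_3 \<epsilon> by (auto simp: x_def field_simps)
  \<comment> \<open>The factor \<open>m \<ge> 3\<close> in \<open>x\<close> absorbs the 2 in
    \<open>2 ^ K < 2 / \<epsilon>\<close>.\<close>
  have "2 / \<epsilon> = 2 * (1 / \<epsilon>)" by simp
  then have "2 / \<epsilon> \<le> x" using x by linarith
  moreover have "2 ^ K < 2 / \<epsilon>" using K(3) \<epsilon> by (simp add: field_simps)
  ultimately have pow: "2 ^ K < x" by linarith
  have "real K < 2 ^ K" by (rule of_nat_less_two_power)
  then have Kx: "real K \<le> x" using pow x by linarith
  have word: "25000 * (m + K) + 3 * m < 2 ^ w"
  proof -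
    have "real (25000 * (m + K) + 3 * m) \<le> 50003 * x" using x Kx by simp
    also have "\<dots> < 3 ^ 11 * x" using x by simp
    also have "\<dots> \<le> x ^ 11 * x" using x by (intro mult_right_mono power_mono) auto
    also have "\<dots> = x powr 12" using x by (simp add: powr_numeral power_Suc2[symmetric])
    also have "\<dots> = (2 powr log 2 x) powr 12" using x by simp
    also have "\<dots> = 2 powr (12 * log 2 x)" by (simp only: powr_powr mult.commute)
    also have "\<dots> \<le> 2 powr real w" using w by (intro powr_mono) (auto simp: x_def)
    also have "\<dots> = real (2 ^ w)" by (simp add: powr_realpow)
    finally show ?thesis by (simp only: of_nat_less_iff)
  qed
  obtain D where D: "set_pmf D \<subseteq> orientations G"
      "tv_dist (orientations G) D (pmf_of_set (sink_free_orientations G)) \<le> \<epsilon>"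
      "yields w (read_orientation G) ([sampler], input_memory G A \<epsilon>)
        (31 * (25000 * (m + K)) + 32 * m + 2 * K + 50) D"
    using sampler_correct[OF K(1,2,4,5) word] by blast
  let ?T = "31 * (25000 * (m + K)) + 32 * m + 2 * K + 50"
  have out: "output_dist w sampler G A \<epsilon> ?T = D" "halts_within w sampler (input_memory G A \<epsilon>) ?T"
    using D(3) unfolding yields_def output_dist_def final_memory_def halts_within_def
      map_pmf_comp o_def by blast+
  have "exp 1 \<le> x" using exp_le x by simp
  then have ln: "1 \<le> ln x" using x by (simp add: ln_ge_iff)
  have "real K * ln 2 = ln (2 ^ K)" by (simp add: ln_realpow)
  also have "\<dots> \<le> ln x" using pow x by (subst ln_le_cancel_iff) auto
  finally have "real K * (1 / 2) \<le> ln x"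
    using ln2_ge_two_thirds mult_left_mono[of "1 / 2" "ln 2" "real K"] by simp
  then have "real K \<le> 2 * ln x" by linarith
  moreover have "ln x \<le> real m * ln x" "real m \<le> real m * ln x"
    using ln m_ge_3 by simp_all
  moreover have "real ?T = 775002 * real K + 775032 * real m + 50" by simp
  ultimately have "real ?T \<le> 3000000 * (real m * ln x)"
    using ln by linarith
  with out D(1,2)
  show "\<exists>T. real T \<le> 3000000 * (real (card (edges G)) * ln (real (card (edges G)) / \<epsilon>)) \<and>
         halts_within w sampler (input_memory G A \<epsilon>) T \<and>
         set_pmf (output_dist w sampler G A \<epsilon> T) \<subseteq> orientations G \<and>
         tv_dist (orientations G) (output_dist w sampler G A \<epsilon> T)
           (pmf_of_set (sink_free_orientations G)) \<le> \<epsilon>"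
    unfolding x_def by metis
qed

end
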